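(* Let $G$ be a finite group and $A \le \mathrm{Inn}(G)$. Then $\Delta(G,A)$ has a universal vertex if and only if there exists a prime $p$ dividing $|Z(G)|$ such that $G$ has a cyclic or generalized quaternion Sylow $p$-subgroup.
   Context: For a finite group $G$ and a subgroup $A \le \mathrm{Aut}(G)$, write $g^A = \{g^a \mid a \in A\}$ for the $A$-orbit of $g \in G$. The automorphic cyclic graph $\Delta(G,A)$ is the simple graph with vertex set $\{g^A : 1 \ne g \in G\}$, in which two distinct vertices $x^A, y^A$ are joined by an edge if there exist $x' \in x^A$ and $y' \in y^A$ such that $\langle x', y' \rangle$ is cyclic. A universal vertex of a graph is a vertex adjacent to all the other vertices. $\mathrm{Inn}(G)$ is the group of inner automorphisms of $G$. *)

theory Defs
  imports
    "HOL-Computational_Algebra.Primes"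
    "HOL-Algebra.Bij"
    "HOL-Algebra.Elementary_Groups"
    "Graph_Theory.Pair_Digraph"
begin

section \<open>Groups\<close>

definition group_center :: "('a, 'b) monoid_scheme \<Rightarrow> 'a set" where
  "group_center G = {z \<in> carrier G. \<forall>g\<in>carrier G. z \<otimes>\<^bsub>G\<^esub> g = g \<otimes>\<^bsub>G\<^esub> z}"

text \<open>The restriction makes the map extensional, as \<^const>\<open>auto\<close> requires.\<close>

definition inner_auto :: "('a, 'b) monoid_scheme \<Rightarrow> 'a \<Rightarrow> 'a \<Rightarrow> 'a" where
  "inner_auto G g = (\<lambda>x\<in>carrier G. g \<otimes>\<^bsub>G\<^esub> x \<otimes>\<^bsub>G\<^esub> inv\<^bsub>G\<^esub> g)"

definition InnGroup :: "('a, 'b) monoid_scheme \<Rightarrow> ('a \<Rightarrow> 'a) monoid" where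
  "InnGroup G = AutoGroup G\<lparr>carrier := inner_auto G ` carrier G\<rparr>"

definition sylow_subgroup :: "nat \<Rightarrow> 'a set \<Rightarrow> ('a, 'b) monoid_scheme \<Rightarrow> bool" where
  "sylow_subgroup p P G \<longleftrightarrow> prime p \<and> subgroup P G \<and> card P = p ^ multiplicity p (order G)"

text \<open>
  The generalized quaternion group of order \<open>2 ^ n\<close>, where \<open>n \<ge> 3\<close> (so the quaternion group of
  order 8 is included), has the presentation
  \<open>\<langle>x, y | x ^ (2 ^ (n - 1)) = 1, y ^ 2 = x ^ (2 ^ (n - 2)), y ^ -1 x y = x ^ -1\<rangle>\<close>.
  A group with generators satisfying these relations is a quotient of the presented group, and
  the condition on the order makes it isomorphic to the presented group.
\<close>

definition generalized_quaternion_group :: "('a, 'b) monoid_scheme \<Rightarrow> bool" where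
  "generalized_quaternion_group Q \<longleftrightarrow> group Q \<and>
     (\<exists>n x y. 3 \<le> n \<and> order Q = 2 ^ n \<and>
        x \<in> carrier Q \<and> y \<in> carrier Q \<and> generate Q {x, y} = carrier Q \<and>
        x [^]\<^bsub>Q\<^esub> ((2::nat) ^ (n - 1)) = \<one>\<^bsub>Q\<^esub> \<and>
        y [^]\<^bsub>Q\<^esub> (2::nat) = x [^]\<^bsub>Q\<^esub> ((2::nat) ^ (n - 2)) \<and>
        inv\<^bsub>Q\<^esub> y \<otimes>\<^bsub>Q\<^esub> x \<otimes>\<^bsub>Q\<^esub> y = inv\<^bsub>Q\<^esub> x)"


section \<open>The automorphic cyclic graph\<close>

definition auto_orbit :: "('a \<Rightarrow> 'a) set \<Rightarrow> 'a \<Rightarrow> 'a set" where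
  "auto_orbit A g = {a g | a. a \<in> A}"

text \<open>A simple graph is a symmetric loop-free digraph, i.e. \<^locale>\<open>pair_graph\<close>.\<close>

definition automorphic_cyclic_graph ::
    "('a, 'b) monoid_scheme \<Rightarrow> ('a \<Rightarrow> 'a) set \<Rightarrow> 'a set pair_pre_digraph" where
  "automorphic_cyclic_graph G A =
     (let V = {auto_orbit A g | g. g \<in> carrier G \<and> g \<noteq> \<one>\<^bsub>G\<^esub>} in
      \<lparr>pverts = V,
       parcs = {(X, Y). X \<in> V \<and> Y \<in> V \<and> X \<noteq> Y \<and>
                  (\<exists>x\<in>X. \<exists>y\<in>Y. cyclic_group (subgroup_generated G {x, y}))}\<rparr>)"

definition universal_vertex :: "('v, 'e) pre_digraph \<Rightarrow> 'v \<Rightarrow> bool" where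
  "universal_vertex D u \<longleftrightarrow> u \<in> verts D \<and> (\<forall>v\<in>verts D. v \<noteq> u \<longrightarrow> u \<rightarrow>\<^bsub>D\<^esub> v)"


section \<open>Well-formedness\<close>

lemma (in group) inner_auto_in_auto:
  assumes "g \<in> carrier G"
  shows "inner_auto G g \<in> auto G"
proof -
  have "inner_auto G g \<in> hom G G"
    using assms by (auto simp: inner_auto_def hom_def m_assoc inv_solve_left)
  moreover have "bij_betw (inner_auto G g) (carrier G) (carrier G)"
    by (rule bij_betw_byWitness[where f' = "\<lambda>x. inv g \<otimes> x \<otimes> g"])
      (use assms in \<open>auto simp: inner_auto_def m_assoc simp flip: m_assoc[of g "inv g"] m_assoc[of "inv g" g]\<close>)
  ultimately show ?thesis
    by (simp add: auto_def Bij_def inner_auto_def)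
qed

lemma (in group) inner_auto_mult:
  assumes "g \<in> carrier G" "h \<in> carrier G"
  shows "inner_auto G g \<otimes>\<^bsub>AutoGroup G\<^esub> inner_auto G h = inner_auto G (g \<otimes> h)"
  using assms inner_auto_in_auto[of g] inner_auto_in_auto[of h]
  by (auto simp: AutoGroup_def BijGroup_def auto_def compose_def inner_auto_def restrict_def
      m_assoc inv_mult_group fun_eq_iff)

lemma (in group) subgroup_inner_autos: "subgroup (inner_auto G ` carrier G) (AutoGroup G)"
proof -
  have "group_hom G (AutoGroup G) (inner_auto G)"
    using AutoGroup inner_auto_in_auto inner_auto_mult
    by (auto simp: group_hom_def group_hom_axioms_def hom_def is_group AutoGroup_def)
  then show ?thesis
    by (rule group_hom.img_is_subgroup)
qed

lemma (in group) group_InnGroup: "group (InnGroup G)"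
  unfolding InnGroup_def
  using subgroup.subgroup_is_group[OF subgroup_inner_autos AutoGroup] .

lemma pair_graph_automorphic_cyclic_graph:
  assumes "finite (carrier G)"
  shows "pair_graph (automorphic_cyclic_graph G A)"
proof -
  let ?V = "{auto_orbit A g | g. g \<in> carrier G \<and> g \<noteq> \<one>\<^bsub>G\<^esub>}"
  have fin: "finite ?V"
    using assms by simp
  have sub: "parcs (automorphic_cyclic_graph G A) \<subseteq> ?V \<times> ?V"
    by (auto simp: automorphic_cyclic_graph_def)
  show ?thesis
  proof unfold_locales
    show "finite (pverts (automorphic_cyclic_graph G A))"
      using fin by (simp add: automorphic_cyclic_graph_def)
    show "finite (parcs (automorphic_cyclic_graph G A))"
      using sub fin by (meson finite_SigmaI finite_subset)
    show "symmetric (with_proj (automorphic_cyclic_graph G A))"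
      unfolding symmetric_def with_proj_simps
      by (rule symI) (auto simp: automorphic_cyclic_graph_def, (metis insert_commute)+)
  qed (auto simp: automorphic_cyclic_graph_def)
qed

end

(*
  Both sides are equivalent to the existence of a central element z of prime order p such that
  every element of order p lies in <z>.  If the orbit of x is universal, every element of G
  commutes with a conjugate of x, so x is central because G is not the union of the conjugates of
  a proper subgroup; then every y lies in a common cyclic group with x, and a power of x serves
  as z.  Conversely such a z lies in a common cyclic group with every y: a generator is y if p
  divides the order of y, and zy otherwise.  On the other side, a Sylow p-subgroup containing z
  has a unique subgroup of order p, which forces it to be cyclic or generalized quaternion; and
  every element of order p is conjugate into a Sylow p-subgroup.
*)
theory Submission
  imports Defs "HOL-Algebra.Group_Action" "HOL-Algebra.Sylow" "HOL-Number_Theory.Residues"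
begin

text \<open>A cyclic group has at most one subgroup of order p. This turns common cyclic overgroups
  into a statement about elements of order p: if z of order p and y with y^p = 1 lie in one <c>,
  then y lies in <z>. The group of automorphisms enters only through its orbits: each is contained
  in a conjugacy class and is a singleton at a central element, which is why the Sylow condition
  does not mention it. In the classification of the Sylow subgroup the obstacle is p = 2. For odd p,
  an element y that normalizes <a> and lies outside it, with y^p in <a^p>, has a solution of u^p = 1
  in its coset; for p = 2 an inverting element escapes, and quaternion groups are what it produces.
  No quotient by <a> is formed: an element of order p in the quotient is a y outside <a> with y^p in
  <a>, and a central one is a coset fixed by conjugation.\<close>

section \<open>A geometric sum, and powers in cyclic and metacyclic groups\<close>

text \<open>Modulo p^2, (1 + p t)^i is 1 + i p t, so the sum is p + p t (p (p - 1) / 2), and (p - 1)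
  / 2 is an integer. Hence the sum is p times a unit modulo every power of p.\<close>

lemma sum_powers_one_mod_prime:
  fixes p t :: nat
  assumes "odd p"
  shows "\<exists>w. (\<Sum>i<p. (1 + p * t) ^ i) = p * (1 + p * w)"
proof -
  have "\<exists>q. (1 + p * t) ^ i = 1 + i * p * t + p\<^sup>2 * q" for i
  proof (induction i)
    case (Suc i)
    then obtain q where "(1 + p * t) ^ i = 1 + i * p * t + p\<^sup>2 * q" by blast
    then have "(1 + p * t) ^ Suc i = 1 + Suc i * p * t + p\<^sup>2 * (i * t * t + q + p * t * q)"
      by (simp add: algebra_simps power2_eq_square)
    then show ?case by blast
  qed auto
  then obtain q where q: "\<And>i. (1 + p * t) ^ i = 1 + i * p * t + p\<^sup>2 * q i" by metis
  obtain h where h: "p = Suc (2 * h)"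
    using assms by (elim oddE) simp
  have gauss: "(\<Sum>i<p. i) = p * h"
    using Sum_Ico_nat[of 0 p] by (simp add: h atLeast0LessThan)
  have "(\<Sum>i<p. (1 + p * t) ^ i) = p + (\<Sum>i<p. i) * (p * t) + p\<^sup>2 * (\<Sum>i<p. q i)"
    unfolding q sum.distrib by (simp add: sum_distrib_left sum_distrib_right mult.assoc)
  also have "\<dots> = p * (1 + p * (h * t + (\<Sum>i<p. q i)))"
    unfolding gauss by (simp add: algebra_simps power2_eq_square)
  finally show ?thesis by blast
qed

context group
begin

text \<open>Finiteness replaces integer exponents by natural ones, so that computations in cyclic
  subgroups become congruences modulo an order.\<close>

lemma in_generate_singleton_iff:
  assumes "finite (carrier G)" "a \<in> carrier G"
  shows "x \<in> generate G {a} \<longleftrightarrow> (\<exists>k::nat. x = a [^] k)"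
  using generate_pow_on_finite_carrier[OF assms] by auto

lemma generate_singleton_subset:
  assumes "a \<in> carrier G" "x \<in> generate G {a}"
  shows "generate G {x} \<subseteq> generate G {a}"
  using assms by (intro generate_subgroup_incl generate_is_subgroup) auto

lemma nat_pow_eq_iff_cong:
  assumes "x \<in> carrier G"
  shows "x [^] (m::nat) = x [^] (n::nat) \<longleftrightarrow> [m = n] (mod ord x)"
  using int_pow_eq[OF assms, of "int m" "int n"]
  by (simp add: int_pow_int cong_iff_dvd_diff dvd_diff_commute flip: cong_int_iff)

text \<open>If ord a = p M, the solutions of y^p = 1 in <a> are the powers of a^M. Here x = a^(M c),
  y = a^(M d), and c is prime to p because x is not trivial; an inverse t of c modulo p gives y =
  x^(t d).\<close>

lemma generate_prime_ord_eq:
  assumes fin: "finite (carrier G)" and a: "a \<in> carrier G" and p: "prime p"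
    and x: "x \<in> generate G {a}" "ord x = p" and y: "y \<in> generate G {a}" "y [^] p = \<one>"
  shows "y \<in> generate G {x}"
proof -
  obtain i j :: nat where ij: "x = a [^] i" "y = a [^] j"
    using x y in_generate_singleton_iff[OF fin a] by blast
  have xc: "x \<in> carrier G" using ij a by simp
  have "a [^] (i * p) = \<one>" using ij(1) a pow_ord_eq_1[OF xc] x(2) by (metis nat_pow_pow)
  then have di: "ord a dvd i * p" using a by (simp add: pow_eq_id)
  have ndi: "\<not> ord a dvd i"
  proof
    assume "ord a dvd i"
    then have "x = \<one>" using ij a by (simp add: pow_eq_id)
    then show False using x(2) p by auto
  qed
  have dj: "ord a dvd j * p" using ij a y by (simp add: nat_pow_pow pow_eq_id)
  \<comment> \<open>Otherwise ord a would be prime to p and, dividing i p, would divide i.\<close>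
  have "p dvd ord a"
  proof (rule ccontr)
    assume "\<not> p dvd ord a"
    then have "coprime (ord a) p" using p prime_imp_coprime coprime_commute by metis
    then show False using di ndi by (simp add: coprime_dvd_mult_left_iff)
  qed
  then obtain M where M: "ord a = p * M" by blast
  have p0: "p > 0" using p prime_gt_0_nat by blast
  obtain c where c: "i = M * c" using di M p0 by (auto simp: mult.commute dvd_def)
  obtain d where d: "j = M * d" using dj M p0 by (auto simp: mult.commute dvd_def)
  have "\<not> p dvd c" using ndi c M by (auto simp: mult.commute)
  then have "coprime c p" using p prime_imp_coprime coprime_commute by metis
  then obtain t where t: "[c * t = 1] (mod p)" using cong_solve_coprime_nat by (metis One_nat_def)
  have "[c * t * d = 1 * d] (mod p)" by (rule cong_scalar_right[OF t])
  then have "[M * (c * t * d) = M * d] (mod M * p)"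
    unfolding cong_def by (simp only: mult_mod_right[symmetric] mult_1)
  then have "[i * (t * d) = j] (mod ord a)" by (simp add: c d M mult.commute mult.left_commute)
  then have "x [^] (t * d) = y" using a by (simp add: ij nat_pow_pow nat_pow_eq_iff_cong)
  then show ?thesis using in_generate_singleton_iff[OF fin xc] by blast
qed

text \<open>Moving y to the right past a power of a multiplies the exponent by r; in the n-th power
  of a^k y the successive factors therefore contribute the exponents k r^i.\<close>

lemma twisted_power:
  assumes a: "a \<in> carrier G" and y: "y \<in> carrier G" and r: "y \<otimes> a = a [^] (r::nat) \<otimes> y"
  shows "y \<otimes> a [^] (k::nat) = a [^] (r * k) \<otimes> y"
    and "(a [^] (k::nat) \<otimes> y) [^] (n::nat) = a [^] (k * (\<Sum>i<n. r ^ i)) \<otimes> y [^] n"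
proof -
  show *: "y \<otimes> a [^] k = a [^] (r * k) \<otimes> y" for k :: nat
  proof (induction k)
    case (Suc k)
    have "y \<otimes> a [^] Suc k = y \<otimes> a [^] k \<otimes> a" using a y by (simp add: m_assoc)
    also have "\<dots> = a [^] (r * k) \<otimes> (y \<otimes> a)" using Suc a y by (simp add: m_assoc)
    also have "\<dots> = a [^] (r * k) \<otimes> a [^] r \<otimes> y" using a y r by (simp add: m_assoc)
    also have "\<dots> = a [^] (r * Suc k) \<otimes> y" using a by (simp add: nat_pow_mult add.commute)
    finally show ?case .
  qed (use y in simp)
  show "(a [^] k \<otimes> y) [^] n = a [^] (k * (\<Sum>i<n. r ^ i)) \<otimes> y [^] n"
  proof (induction n)
    case (Suc n)
    \<comment> \<open>The sum is extended at its low end, since the new factor stands on the left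
      and its y multiplies all later exponents by r.\<close>
    have S: "(\<Sum>i<Suc n. r ^ i) = 1 + r * (\<Sum>i<n. r ^ i)"
      by (simp add: sum.lessThan_Suc_shift sum_distrib_left del: sum.lessThan_Suc)
    have "(a [^] k \<otimes> y) [^] Suc n = a [^] k \<otimes> y \<otimes> (a [^] k \<otimes> y) [^] n"
      using a y nat_pow_Suc2[of "a [^] k \<otimes> y" n] by simp
    also have "\<dots> = a [^] k \<otimes> (y \<otimes> a [^] (k * (\<Sum>i<n. r ^ i))) \<otimes> y [^] n"
      using a y Suc by (simp add: m_assoc)
    also have "\<dots> = a [^] k \<otimes> a [^] (r * (k * (\<Sum>i<n. r ^ i))) \<otimes> (y \<otimes> y [^] n)"
      using a y by (simp add: * m_assoc)
    also have "\<dots> = a [^] (k * (\<Sum>i<Suc n. r ^ i)) \<otimes> y [^] Suc n"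
      unfolding S nat_pow_Suc2[OF y] using a y by (simp add: nat_pow_mult algebra_simps del: sum.lessThan_Suc)
    finally show ?case .
  qed (use a y in simp)
qed

end

section \<open>\<open>p\<close>-groups with a unique subgroup of order \<open>p\<close>\<close>

text \<open><z> is the only subgroup of order p. The condition y^p = 1 in place of ord y = p adds
  only the trivial element and is visibly preserved by conjugation.\<close>

locale unique_order_p_group = group G for G (structure) +
  fixes p n :: nat and z
  assumes p: "prime p" and order_eq: "order G = p ^ n"
    and z: "z \<in> carrier G" "ord z = p"
    and unique: "\<And>y. y \<in> carrier G \<Longrightarrow> y [^] p = \<one> \<Longrightarrow> y \<in> generate G {z}"
begin

lemma fin: "finite (carrier G)"
  using order_eq p order_gt_0_iff_finite by (metis prime_gt_0_nat zero_less_power)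

lemmas in_gen = in_generate_singleton_iff[OF fin]

lemma ord_prime_power: "x \<in> carrier G \<Longrightarrow> \<exists>m. ord x = p ^ m"
  using ord_dvd_group_order order_eq p divides_primepow_nat by metis

text \<open>A nontrivial a has a power b of order p. By uniqueness b lies in <z>, and then z lies in
  <b>, since both have order p.\<close>

lemma z_in_generate:
  assumes a: "a \<in> carrier G" "a \<noteq> \<one>"
  shows "z \<in> generate G {a}"
proof -
  obtain m where m: "ord a = p ^ m" using ord_prime_power a by blast
  have "m \<noteq> 0" using m a ord_eq_1 by (metis power_0)
  then obtain m' where m': "ord a = p ^ m' * p" using m by (metis not0_implies_Suc power_Suc2)
  define b where "b = a [^] (p ^ m')"
  have p0: "p ^ m' > 0" using p prime_gt_0_nat by simp
  have b: "b \<in> carrier G" "ord b = p" unfolding b_def using a m' p0 by (simp_all add: ord_pow)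
  have "b [^] p = \<one>" using b pow_ord_eq_1 by metis
  then have "b \<in> generate G {z}" using unique b by blast
  moreover have "z \<in> generate G {z}" by (simp add: generate.incl)
  moreover have "z [^] p = \<one>" using z pow_ord_eq_1 by metis
  ultimately have "z \<in> generate G {b}" using generate_prime_ord_eq[OF fin z(1) p] b by blast
  moreover have "b \<in> generate G {a}" using in_gen a b_def by blast
  ultimately show ?thesis using generate_singleton_subset a by blast
qed

lemma in_generate_of_pow_p:
  assumes "a \<in> carrier G" "a \<noteq> \<one>" "y \<in> carrier G" "y [^] p = \<one>"
  shows "y \<in> generate G {a}"
  using z_in_generate[OF assms(1,2)] unique[OF assms(3,4)] generate_singleton_subset assms(1) by blast

lemma involution_eq:
  assumes "p = 2" "u \<in> carrier G" "u \<otimes> u = \<one>" "u \<noteq> \<one>"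
  shows "u = z"
proof -
  have "u [^] p = \<one>" using assms by (simp add: numeral_2_eq_2)
  then obtain k :: nat where k: "u = z [^] k" using unique assms in_gen z by blast
  have "[k = k mod 2] (mod 2)" by (simp add: cong_def)
  then have "u = z [^] (k mod 2)" using k z nat_pow_eq_iff_cong assms(1) by metis
  moreover have "k mod 2 = 0 \<or> k mod 2 = 1" by auto
  ultimately show ?thesis using assms z by auto
qed

text \<open>The power formula \<open>(a\<^sup>k y)\<^sup>p = a\<^sup>(k S) y\<^sup>p\<close> with \<open>S = 1 + r + \<dots> + r\<^sup>p\<^sup>-\<^sup>1\<close> shows that some element of
  the coset of \<open>y\<close> has order \<open>p\<close>, against uniqueness, as soon as \<open>S\<close> is exactly divisible by \<open>p\<close>.
  This always happens except for \<open>p = 2\<close> and \<open>r\<close> congruent to 3 modulo 4.\<close>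

lemma inverting_of_normalizing:
  assumes a: "a \<in> carrier G" "a \<noteq> \<one>" and y: "y \<in> carrier G" "y \<notin> generate G {a}"
    and j: "y [^] p = a [^] (p * j)" and r: "y \<otimes> a = a [^] (r::nat) \<otimes> y"
  shows "p = 2 \<and> y \<otimes> a = inv a \<otimes> y \<and> y \<otimes> y = z \<and> 4 dvd ord a"
proof -
  obtain m where m: "ord a = p ^ m" using ord_prime_power a by blast
  have m0: "m \<noteq> 0" using m a ord_eq_1 by (metis power_0)
  have p1: "p > 1" using p prime_gt_1_nat by blast
  have subA: "subgroup (generate G {a}) G" using a by (simp add: generate_is_subgroup)
  have pow_in: "a [^] k \<in> generate G {a}" for k :: nat using in_gen a by blast
  \<comment> \<open>Such an element would lie in <a> by uniqueness, and y with it.\<close>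
  have no_coset: "(a [^] k \<otimes> y) [^] p \<noteq> \<one>" for k :: nat
  proof
    assume "(a [^] k \<otimes> y) [^] p = \<one>"
    then have "a [^] k \<otimes> y \<in> generate G {a}" using in_generate_of_pow_p a y by simp
    then have "inv (a [^] k) \<otimes> (a [^] k \<otimes> y) \<in> generate G {a}"
      using subA pow_in subgroup.m_closed subgroup.m_inv_closed by metis
    then show False using y a by (simp flip: m_assoc)
  qed
  have yk: "y [^] k \<otimes> a = a [^] (r ^ k) \<otimes> y [^] k" for k :: nat
  proof (induction k)
    case (Suc k)
    have "y [^] Suc k \<otimes> a = y [^] k \<otimes> (y \<otimes> a)" using a y by (simp add: m_assoc)
    also have "\<dots> = y [^] k \<otimes> a [^] r \<otimes> y" using a y r by (simp add: m_assoc)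
    also have "\<dots> = a [^] (r ^ k * r) \<otimes> y [^] k \<otimes> y"
      using twisted_power(1)[OF a(1) _ Suc] y by simp
    finally show ?case using a y by (simp add: m_assoc mult.commute)
  qed (use a y in simp)
  \<comment> \<open>Being a power of a, y^p commutes with a; it also conjugates a to a^(r^p), so r^p
    = 1 modulo ord a. Together with Fermat's r^p = r modulo p this gives r = 1 modulo p.\<close>
  have "y [^] p \<otimes> a = a \<otimes> y [^] p"
    using a nat_pow_Suc2[OF a(1), of "p * j"] by (simp add: j)
  then have "a [^] (r ^ p) \<otimes> y [^] p = a \<otimes> y [^] p" using yk by simp
  then have "a [^] (r ^ p) = a [^] (1::nat)" using a y by simp
  then have rp: "[r ^ p = 1] (mod p ^ m)" using a m nat_pow_eq_iff_cong by metis
  then have "[r ^ p = 1] (mod p)" by (rule cong_dvd_modulus_nat) (use m0 in \<open>simp add: dvd_power\<close>)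
  moreover have "\<not> p dvd r"
  proof
    assume "p dvd r"
    moreover have "r dvd r ^ p" using p1 by (intro dvd_power) simp
    ultimately have "p dvd r ^ p" by (rule dvd_trans)
    then have "p dvd 1" using \<open>[r ^ p = 1] (mod p)\<close> cong_dvd_iff by blast
    then show False using p1 by simp
  qed
  then have "[r ^ (p - 1) * r = 1 * r] (mod p)"
    using fermat_theorem p cong_scalar_right by blast
  then have "[r ^ p = r] (mod p)" using p1 by (simp flip: power_minus_mult)
  ultimately have r1: "[r = 1] (mod p)" using cong_sym cong_trans by blast
  then have rt: "r = 1 + p * (r div p)"
    using p1 by (metis add.commute cong_def mod_less mult_div_mod_eq)
  \<comment> \<open>With v inverse to 1 + p w modulo p^m, and p^m - 1 standing for -1, the exponent
    k = v j (p^m - 1) makes k S + p j divisible by p^m, so (a^k y)^p = 1.\<close>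
  have noS: False if S: "(\<Sum>i<p. r ^ i) = p * (1 + p * w)" for w
  proof -
    have "coprime (1 + p * w) p" by (rule coprimeI) (metis dvd_add_left_iff dvd_mult2)
    then have "coprime (1 + p * w) (p ^ m)" by simp
    then obtain v where "[(1 + p * w) * v = 1] (mod p ^ m)"
      using cong_solve_coprime_nat[of "1 + p * w" "p ^ m"] by auto
    then have "[(1 + p * w) * v * (p * j * (p ^ m - 1)) = 1 * (p * j * (p ^ m - 1))] (mod p ^ m)"
      by (rule cong_scalar_right)
    then have "[(1 + p * w) * v * (p * j * (p ^ m - 1)) + p * j
        = 1 * (p * j * (p ^ m - 1)) + p * j] (mod p ^ m)"
      by (rule cong_add) (rule cong_refl)
    moreover have "1 * (p * j * (p ^ m - 1)) + p * j = p ^ m * (p * j)"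
      using p1 by (cases "p ^ m") (simp_all add: algebra_simps)
    moreover have "(1 + p * w) * v * (p * j * (p ^ m - 1)) = v * j * (p ^ m - 1) * (p * (1 + p * w))"
      by (simp only: mult_ac)
    ultimately have "[v * j * (p ^ m - 1) * (p * (1 + p * w)) + p * j = p ^ m * (p * j)] (mod p ^ m)"
      by (simp only:)
    then have dvd: "p ^ m dvd v * j * (p ^ m - 1) * (p * (1 + p * w)) + p * j"
      using cong_dvd_iff dvd_triv_left by blast
    have "(a [^] (v * j * (p ^ m - 1)) \<otimes> y) [^] p
        = a [^] (v * j * (p ^ m - 1) * (p * (1 + p * w)) + p * j)"
      unfolding twisted_power(2)[OF a(1) y(1) r] S j by (rule nat_pow_mult[OF a(1)])
    also have "\<dots> = \<one>"
      using dvd pow_eq_id[OF a(1)] m by (simp only:)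
    finally show False
      using no_coset by blast
  qed
  have p2: "p = 2"
  proof (rule ccontr)
    assume "p \<noteq> 2"
    then have "odd p" using p prime_odd_nat p1 by force
    then show False using sum_powers_one_mod_prime[of p "r div p"] rt noS by metis
  qed
  define t where "t = r div 2"
  have rt: "r = 1 + 2 * t" using rt p2 t_def by simp
  \<comment> \<open>For even t the sum 1 + r = 2 (1 + t) is twice an odd number, which
    \<open>noS\<close> excludes. Thus r = 3 modulo 4, and t cancels modulo powers of 2.\<close>
  have "odd t"
  proof
    assume "even t"
    then obtain s where "t = 2 * s" by blast
    then have "(\<Sum>i<p. r ^ i) = p * (1 + p * s)" using rt p2 by (simp add: numeral_2_eq_2)
    then show False using noS by blast
  qed
  then have codd: "coprime t (2 ^ k)" for k by simp
  have y2: "y \<otimes> y = y [^] p" using p2 y by (simp add: numeral_2_eq_2)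
  have "y \<otimes> y \<noteq> \<one>" using no_coset[of 0] y y2 by simp
  \<comment> \<open>y commutes with y^2 = a^(2 j) but also conjugates it to a^(2 j r). As r - 1 = 2
    t, this gives 4 t j = 0 modulo ord a, hence 4 j = 0 and y^4 = a^(4 j) = 1.\<close>
  moreover have "(y \<otimes> y) \<otimes> (y \<otimes> y) = \<one>"
  proof -
    have "y \<otimes> y [^] p = y [^] p \<otimes> y" using nat_pow_Suc2[OF y(1), of p] by simp
    then have "a [^] (r * (p * j)) \<otimes> y = a [^] (p * j) \<otimes> y"
      unfolding j twisted_power(1)[OF a(1) y(1) r] .
    then have "a [^] (r * (p * j)) = a [^] (p * j)"
      using a y by simp
    then have "[r * (p * j) = p * j] (mod 2 ^ m)" using a m p2 nat_pow_eq_iff_cong by simp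
    moreover have "r * (p * j) = t * (4 * j) + p * j" using rt p2 by (simp add: algebra_simps)
    ultimately have "[t * (4 * j) + p * j = 0 + p * j] (mod 2 ^ m)" by simp
    then have "2 ^ m dvd t * (4 * j)" unfolding cong_add_rcancel_nat cong_0_iff .
    then have "2 ^ m dvd 4 * j"
      using codd[of m] by (simp add: coprime_dvd_mult_right_iff coprime_commute)
    then have "a [^] (4 * j) = \<one>" using a m p2 by (simp add: pow_eq_id)
    then show ?thesis using a j p2 by (simp add: y2 nat_pow_mult)
  qed
  ultimately have yz: "y \<otimes> y = z" using involution_eq p2 y by simp
  have zz: "z \<otimes> z = \<one>" using yz \<open>(y \<otimes> y) \<otimes> (y \<otimes> y) = \<one>\<close> by simp
  \<comment> \<open>From r^2 = 1 modulo ord a follow 4 t (t + 1) = 0 and 2 (1 + r) = 4 (t + 1) = 0.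
    If a^(1 + r) were not 1, it would be the involution z, and (a y)^2 = a^(1 + r) y^2 = z z =
    1.\<close>
  have "a [^] (1 + r) = \<one>"
  proof (rule ccontr)
    assume ne: "a [^] (1 + r) \<noteq> \<one>"
    have "[(1 + 2 * t) ^ 2 = 1] (mod 2 ^ m)" using rp rt p2 by simp
    moreover have "(1 + 2 * t) ^ 2 = t * (4 * (t + 1)) + 1"
      by (simp add: algebra_simps power2_eq_square)
    ultimately have "[t * (4 * (t + 1)) + 1 = 0 + 1] (mod 2 ^ m)" by simp
    then have "2 ^ m dvd t * (4 * (t + 1))" unfolding cong_add_rcancel_nat cong_0_iff .
    then have "2 ^ m dvd 4 * (t + 1)"
      using codd[of m] by (simp add: coprime_dvd_mult_right_iff coprime_commute)
    moreover have "4 * (t + 1) = (1 + r) + (1 + r)" using rt by simp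
    ultimately have "a [^] ((1 + r) + (1 + r)) = \<one>"
      using m p2 by (simp only: pow_eq_id[OF a(1)])
    then have "a [^] (1 + r) \<otimes> a [^] (1 + r) = \<one>"
      by (simp only: nat_pow_mult[OF a(1)])
    then have "a [^] (1 + r) = z" using ne involution_eq p2 a by simp
    then have "(a [^] (1::nat) \<otimes> y) [^] p = \<one>"
      unfolding twisted_power(2)[OF a(1) y(1) r] y2[symmetric] yz using p2 zz by (simp add: numeral_2_eq_2)
    then show False using no_coset by blast
  qed
  then have "a [^] r = inv a"
    using a by (intro inv_equality[symmetric]) simp_all
  moreover have "4 dvd ord a"
  proof -
    have "m \<noteq> 1"
    proof
      assume "m = 1"
      then have "y [^] p = \<one>" using j a m by (simp add: pow_eq_id)
      then show False using no_coset[of 0] y by simp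
    qed
    then have "2 ^ 2 dvd (2::nat) ^ m" using m0 by (intro le_imp_power_dvd) simp
    then show ?thesis using m p2 by simp
  qed
  ultimately show ?thesis using p2 yz r by simp
qed

end

lemma not_4_dvd_Suc_square: "\<not> 4 dvd Suc (s * s)"
proof (cases "even s")
  case True
  then obtain t where "s = 2 * t" by blast
  then have "Suc (s * s) = 4 * (t * t) + 1" by simp
  then show ?thesis by presburger
next
  case False
  then obtain t where "s = 2 * t + 1" using oddE by blast
  then have "Suc (s * s) = 4 * (t * t + t) + 2" by (simp add: algebra_simps)
  then show ?thesis by presburger
qed

section \<open>Fixed points of p-groups acting on finite sets and on cosets\<close>

context group
begin

text \<open>Orbit sizes divide p^n and add up to a number not divisible by p, so some orbit is a
  singleton. The action is a bare function with closure conditions on E; its restriction to E is the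
  extensional map that \<open>group_action\<close> requires.\<close>

lemma p_group_fixed_point:
  assumes p: "prime p" and ord: "order G = p ^ n" and E: "finite E" "\<not> p dvd card E"
    and closed: "\<And>g x. g \<in> carrier G \<Longrightarrow> x \<in> E \<Longrightarrow> act g x \<in> E"
    and one: "\<And>x. x \<in> E \<Longrightarrow> act \<one> x = x"
    and mult: "\<And>g h x. g \<in> carrier G \<Longrightarrow> h \<in> carrier G \<Longrightarrow> x \<in> E \<Longrightarrow> act (g \<otimes> h) x = act g (act h x)"
  shows "\<exists>x\<in>E. \<forall>g\<in>carrier G. act g x = x"
proof -
  define \<phi> where "\<phi> g = restrict (act g) E" for g
  have inv: "act (inv g) (act g x) = x \<and> act g (act (inv g) x) = x" if "g \<in> carrier G" "x \<in> E" for g x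
    using that mult[of "inv g" g x] mult[of g "inv g" x] one by simp
  have bij: "\<phi> g \<in> Bij E" if "g \<in> carrier G" for g
  proof -
    have "bij_betw (\<phi> g) E E"
      by (rule bij_betw_byWitness[where f' = "act (inv g)"]) (use that inv closed in \<open>auto simp: \<phi>_def\<close>)
    then show ?thesis by (simp add: Bij_def \<phi>_def)
  qed
  have "\<phi> (g \<otimes> h) = compose E (\<phi> g) (\<phi> h)" if "g \<in> carrier G" "h \<in> carrier G" for g h
    using that mult closed by (auto simp: \<phi>_def compose_def fun_eq_iff)
  then interpret group_action G E \<phi>
    using bij group_BijGroup[of E]
    by (auto simp: group_action_def group_hom_def group_hom_axioms_def hom_def BijGroup_def is_group)
  have "\<exists>x\<in>E. \<not> p dvd card (orbit G \<phi> x)"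
  proof (rule ccontr)
    assume "\<not> (\<exists>x\<in>E. \<not> p dvd card (orbit G \<phi> x))"
    then have "p dvd card (\<Union> (orbits G E \<phi>))"
      using E(1) disjoint_union by (intro dvd_partition) (auto simp: orbits_coverture, auto simp: orbits_def)
    then show False using E by (simp add: orbits_coverture)
  qed
  then obtain x where x: "x \<in> E" "\<not> p dvd card (orbit G \<phi> x)" by blast
  have "card (orbit G \<phi> x) dvd p ^ n"
    using orbit_stabilizer_theorem[OF x(1)] ord by (metis dvd_triv_left)
  then have "card (orbit G \<phi> x) = 1"
    using x(2) p by (metis divides_primepow_nat dvd_power neq0_conv power_0)
  then obtain u where u: "orbit G \<phi> x = {u}" by (rule card_1_singletonE)
  then have "\<phi> g x = u" if "g \<in> carrier G" for g
    using that unfolding orbit_def by blast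
  then have "\<phi> g x = \<phi> \<one> x" if "g \<in> carrier G" for g
    using that by simp
  then show ?thesis using x(1) one by (auto simp: \<phi>_def)
qed

lemma conj_nat_pow:
  assumes "g \<in> carrier G" "x \<in> carrier G"
  shows "(g \<otimes> x \<otimes> inv g) [^] (k::nat) = g \<otimes> x [^] k \<otimes> inv g"
proof (induction k)
  case (Suc k)
  have "inv g \<otimes> (g \<otimes> (x \<otimes> inv g)) = x \<otimes> inv g"
    using assms by (simp flip: m_assoc)
  then show ?case using assms Suc by (simp add: m_assoc)
qed (use assms in simp)

text \<open>Read modulo A: a nontrivial normal subgroup of a p-group contains a nontrivial central
  element. Conjugation permutes the p^k cosets of A in C, where k > 0, and fixes A itself, so it
  acts on the remaining p^k - 1 cosets, a number not divisible by p.\<close>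

lemma p_group_fixed_coset:
  assumes p: "prime p" and ord: "order G = p ^ n"
    and A: "subgroup A G" and C: "subgroup C G" and AC: "A \<subset> C"
    and nA: "\<And>g x. g \<in> carrier G \<Longrightarrow> x \<in> A \<Longrightarrow> g \<otimes> x \<otimes> inv g \<in> A"
    and nC: "\<And>g x. g \<in> carrier G \<Longrightarrow> x \<in> C \<Longrightarrow> g \<otimes> x \<otimes> inv g \<in> C"
  shows "\<exists>c\<in>C - A. \<forall>g\<in>carrier G. \<exists>b\<in>A. g \<otimes> c \<otimes> inv g = b \<otimes> c"
proof -
  have fin: "finite (carrier G)"
    using ord p order_gt_0_iff_finite by (metis prime_gt_0_nat zero_less_power)
  have Ac: "A \<subseteq> carrier G" and Cc: "C \<subseteq> carrier G" using A C subgroup.subset by auto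
  interpret C: group "G\<lparr>carrier := C\<rparr>" using C subgroup_imp_group by blast
  have AsubC: "subgroup A (G\<lparr>carrier := C\<rparr>)"
    using A C AC by (simp add: subgroup_incl less_imp_le)
  define R where "R = (\<lambda>c. A #> c) ` C"
  have R: "R = rcosets\<^bsub>G\<lparr>carrier := C\<rparr>\<^esub> A" by (auto simp: R_def RCOSETS_def)
  have finC: "finite C" and finA: "finite A" using fin Ac Cc finite_subset by auto
  have cardR: "card R * card A = card C"
    using C.lagrange[OF AsubC] by (simp add: R order_def)
  have "card C dvd p ^ n" using lagrange[OF C] ord by (metis dvd_triv_right)
  then have "card R dvd p ^ n" using cardR by (metis dvd_mult_left dvd_trans dvd_refl)
  then obtain k where k: "card R = p ^ k" using p divides_primepow_nat by blast
  have "card R \<noteq> 1" using cardR AC finC psubset_card_mono[of C A] by auto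
  then have k0: "k \<noteq> 0" using k by (metis power_0)
  have conj: "(\<lambda>x. g \<otimes> x \<otimes> inv g) ` (A #> c) = A #> (g \<otimes> c \<otimes> inv g)"
    if g: "g \<in> carrier G" and c: "c \<in> C" for g c
  proof -
    have cc: "c \<in> carrier G" using c Cc by blast
    have eq: "g \<otimes> (b \<otimes> c) \<otimes> inv g = (g \<otimes> b \<otimes> inv g) \<otimes> (g \<otimes> c \<otimes> inv g)" if "b \<in> carrier G" for b
    proof -
      have "inv g \<otimes> (g \<otimes> (c \<otimes> inv g)) = c \<otimes> inv g" using g cc by (simp flip: m_assoc)
      then show ?thesis using that g cc by (simp add: m_assoc)
    qed
    have preimage: "\<exists>b'\<in>A. b = g \<otimes> b' \<otimes> inv g" if b: "b \<in> A" for b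
    proof
      show "inv g \<otimes> b \<otimes> g \<in> A" using nA[of "inv g" b] g b by simp
      have "b \<in> carrier G" using b Ac by blast
      then show "b = g \<otimes> (inv g \<otimes> b \<otimes> g) \<otimes> inv g" using g by (simp add: m_assoc flip: m_assoc[of g "inv g"])
    qed
    show ?thesis
    proof
      show "(\<lambda>x. g \<otimes> x \<otimes> inv g) ` (A #> c) \<subseteq> A #> (g \<otimes> c \<otimes> inv g)"
        using eq nA[OF g] Ac by (auto simp: r_coset_def)
      show "A #> (g \<otimes> c \<otimes> inv g) \<subseteq> (\<lambda>x. g \<otimes> x \<otimes> inv g) ` (A #> c)"
      proof
        fix x assume "x \<in> A #> (g \<otimes> c \<otimes> inv g)"
        then obtain b where b: "b \<in> A" "x = b \<otimes> (g \<otimes> c \<otimes> inv g)" by (auto simp: r_coset_def)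
        then obtain b' where b': "b' \<in> A" "b = g \<otimes> b' \<otimes> inv g" using preimage by blast
        then have "x = g \<otimes> (b' \<otimes> c) \<otimes> inv g" using b eq[of b'] Ac by auto
        moreover have "b' \<otimes> c \<in> A #> c" using b' by (auto simp: r_coset_def)
        ultimately show "x \<in> (\<lambda>x. g \<otimes> x \<otimes> inv g) ` (A #> c)" by blast
      qed
    qed
  qed
  have A1: "A #> \<one> = A" using Ac coset_mult_one by blast
  have AR: "A \<in> R" using A1 subgroup.one_closed[OF C] unfolding R_def by force
  have "\<exists>X\<in>R - {A}. \<forall>g\<in>carrier G. (\<lambda>x. g \<otimes> x \<otimes> inv g) ` X = X"
  proof (rule p_group_fixed_point[OF p ord])
    show "finite (R - {A})" using finC by (simp add: R_def)
    have "card (R - {A}) = p ^ k - 1" using AR k by simp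
    moreover have "p ^ k > 0" using p prime_gt_0_nat by simp
    moreover have "p dvd p ^ k" using k0 by (simp add: dvd_power)
    ultimately show "\<not> p dvd card (R - {A})"
      using p by (metis One_nat_def dvd_diffD1 less_eq_Suc_le not_prime_unit nat_dvd_1_iff_1)
  next
    fix g X assume g: "g \<in> carrier G" and X: "X \<in> R - {A}"
    then obtain c where c: "c \<in> C" "X = A #> c" by (auto simp: R_def)
    have cc: "c \<in> carrier G" using c Cc by blast
    have im: "(\<lambda>x. g \<otimes> x \<otimes> inv g) ` X = A #> (g \<otimes> c \<otimes> inv g)" using conj g c by simp
    \<comment> \<open>By normality of A, a conjugate of c lies in A only if c does.\<close>
    have "A #> (g \<otimes> c \<otimes> inv g) \<noteq> A"
    proof
      assume "A #> (g \<otimes> c \<otimes> inv g) = A"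
      then have "g \<otimes> c \<otimes> inv g \<in> A" using coset_join1 A g cc by simp
      then have "inv g \<otimes> (g \<otimes> c \<otimes> inv g) \<otimes> inv (inv g) \<in> A" using nA g by blast
      moreover have "inv g \<otimes> (g \<otimes> c \<otimes> inv g) \<otimes> inv (inv g) = c"
        using g cc by (simp add: m_assoc flip: m_assoc[of "inv g" g])
      ultimately show False using coset_join2[OF cc A] X c by simp
    qed
    then show "(\<lambda>x. g \<otimes> x \<otimes> inv g) ` X \<in> R - {A}" using im nC[OF g c(1)] by (auto simp: R_def)
  next
    fix X assume "X \<in> R - {A}"
    then have "X \<subseteq> carrier G" using r_coset_subset_G[OF Ac] Cc by (auto simp: R_def)
    then show "(\<lambda>x. \<one> \<otimes> x \<otimes> inv \<one>) ` X = X" by (force simp: subset_iff)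
  next
    fix g h X assume g: "g \<in> carrier G" and h: "h \<in> carrier G" and "X \<in> R - {A}"
    then have "X \<subseteq> carrier G" using r_coset_subset_G[OF Ac] Cc by (auto simp: R_def)
    then have "g \<otimes> h \<otimes> x \<otimes> inv (g \<otimes> h) = g \<otimes> (h \<otimes> x \<otimes> inv h) \<otimes> inv g" if "x \<in> X" for x
      using that g h by (auto simp: inv_mult_group m_assoc)
    then show "(\<lambda>x. g \<otimes> h \<otimes> x \<otimes> inv (g \<otimes> h)) ` X
        = (\<lambda>x. g \<otimes> x \<otimes> inv g) ` (\<lambda>x. h \<otimes> x \<otimes> inv h) ` X"
      by (simp add: image_image)
  qed
  then obtain c where c: "c \<in> C" "A #> c \<noteq> A"
    and fixed: "\<And>g. g \<in> carrier G \<Longrightarrow> (\<lambda>x. g \<otimes> x \<otimes> inv g) ` (A #> c) = A #> c"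
    by (auto simp: R_def)
  have cc: "c \<in> carrier G" using c Cc by blast
  show ?thesis
  proof (rule bexI[of _ c], rule ballI)
    show "c \<in> C - A" using c coset_join2[OF cc A] by blast
    fix g assume "g \<in> carrier G"
    then have "g \<otimes> c \<otimes> inv g \<in> A #> c" using fixed rcos_self[OF cc A] by blast
    then show "\<exists>b\<in>A. g \<otimes> c \<otimes> inv g = b \<otimes> c" by (auto simp: r_coset_def)
  qed
qed

lemma inverting_element:
  assumes a: "a \<in> carrier G" and x: "x \<in> carrier G" and xa: "x \<otimes> a = inv a \<otimes> x"
  shows "x \<otimes> inv a = a \<otimes> x" "inv x \<otimes> a \<otimes> x = inv a" "inv x \<otimes> a = inv a \<otimes> inv x"
proof -
  have "a \<otimes> x = a \<otimes> (x \<otimes> a) \<otimes> inv a" using a x by (simp add: m_assoc)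
  also have "\<dots> = x \<otimes> inv a" using a x xa by (simp flip: m_assoc)
  finally show 1: "x \<otimes> inv a = a \<otimes> x" by simp
  have "inv x \<otimes> a \<otimes> x = inv x \<otimes> (x \<otimes> inv a)" using a x 1 by (simp add: m_assoc)
  then show 2: "inv x \<otimes> a \<otimes> x = inv a" using a x by (simp flip: m_assoc)
  have "inv x \<otimes> a = inv x \<otimes> a \<otimes> x \<otimes> inv x" using a x by (simp add: m_assoc)
  then show "inv x \<otimes> a = inv a \<otimes> inv x" using 2 by simp
qed

end

section \<open>Maximal normal cyclic subgroups and the classification\<close>

context unique_order_p_group
begin

text \<open>The sequence w, w^p, w^(p^2), ... reaches 1; its last term outside A has order p modulo
  A.\<close>

lemma minimal_prime_power:
  assumes A: "subgroup A G" and w: "w \<in> carrier G" "w \<notin> A"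
  obtains k where "w [^] (p ^ k) \<notin> A" "w [^] (p ^ Suc k) \<in> A"
proof -
  have "w [^] (p ^ n) \<in> A" using pow_order_eq_1[OF w(1)] order_eq subgroup.one_closed[OF A] by simp
  then obtain l where l: "w [^] (p ^ l) \<in> A" "\<forall>i<l. w [^] (p ^ i) \<notin> A"
    using exists_least_iff[of "\<lambda>i. w [^] (p ^ i) \<in> A"] by blast
  have "l \<noteq> 0"
  proof
    assume "l = 0"
    then show False using l w by simp
  qed
  then obtain k where "l = Suc k" using not0_implies_Suc by blast
  then show ?thesis using l that by blast
qed

text \<open>Write y^p = a^i. If p does not divide i, then i is invertible modulo ord a, so a is a
  power of y^p and <a> lies in <y>.\<close>

lemma pow_p_cases:
  assumes a: "a \<in> carrier G" and y: "y \<in> carrier G" "y [^] p \<in> generate G {a}"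
  obtains j :: nat where "y [^] p = a [^] (p * j)" | t :: nat where "a = y [^] (p * t)"
proof -
  obtain i :: nat where i: "y [^] p = a [^] i" using y in_gen[OF a] by blast
  obtain m where m: "ord a = p ^ m" using ord_prime_power a by blast
  show ?thesis
  proof (cases "p dvd i")
    case True
    then show ?thesis using i that(1) by (metis dvdE)
  next
    case False
    then have "coprime i (ord a)" using p prime_imp_coprime coprime_commute m by (metis coprime_power_right_iff)
    then obtain t where "[i * t = 1] (mod ord a)" using cong_solve_coprime_nat by (metis One_nat_def)
    then have "a [^] (i * t) = a [^] (1::nat)" using nat_pow_eq_iff_cong a by blast
    then have "a = y [^] (p * t)" using a y i by (metis nat_pow_pow nat_pow_eone)
    then show ?thesis using that(2) by blast
  qed
qed

theorem cyclic_or_generalized_quaternion: "cyclic_group G \<or> generalized_quaternion_group G"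
proof -
  txt \<open>\<open>A\<close> is a maximal normal cyclic subgroup. It is its own centralizer \<open>C\<close>, and every element
    outside \<open>A\<close> inverts \<open>A\<close>, so that \<open>A\<close> has index at most 2.\<close>
  define N where "N = {a \<in> carrier G. a \<noteq> \<one> \<and> (\<forall>g\<in>carrier G. g \<otimes> a \<otimes> inv g \<in> generate G {a})}"
  have "z \<in> N"
  proof -
    have "z \<noteq> \<one>" using z p by auto
    moreover have "g \<otimes> z \<otimes> inv g \<in> generate G {z}" if g: "g \<in> carrier G" for g
    proof -
      have "z [^] p = \<one>" using z pow_ord_eq_1 by metis
      then have "(g \<otimes> z \<otimes> inv g) [^] p = \<one>" using g z by (simp add: conj_nat_pow)
      then show ?thesis using unique g z by simp
    qed
    ultimately show ?thesis using z by (simp add: N_def)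
  qed
  moreover have "finite N" using fin by (simp add: N_def)
  ultimately have "Max (ord ` N) \<in> ord ` N" and "\<And>b. b \<in> N \<Longrightarrow> ord b \<le> Max (ord ` N)"
    by (auto intro!: Max_in)
  then obtain a where aN: "a \<in> N" and max: "\<And>b. b \<in> N \<Longrightarrow> ord b \<le> ord a"
    by auto
  define A where "A = generate G {a}"
  have a: "a \<in> carrier G" "a \<noteq> \<one>" using aN by (auto simp: N_def)
  have A: "subgroup A G" using a by (simp add: A_def generate_is_subgroup)
  have inA: "x \<in> A \<longleftrightarrow> (\<exists>k::nat. x = a [^] k)" for x using in_gen a A_def by simp
  have Ac: "A \<subseteq> carrier G" using A subgroup.subset by blast
  have nA: "g \<otimes> x \<otimes> inv g \<in> A" if g: "g \<in> carrier G" and x: "x \<in> A" for g x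
  proof -
    obtain k :: nat where k: "x = a [^] k" using x inA by blast
    obtain l :: nat where "g \<otimes> a \<otimes> inv g = a [^] l" using aN g inA A_def unfolding N_def by blast
    then have "g \<otimes> x \<otimes> inv g = a [^] (l * k)" using k g a by (simp add: nat_pow_pow flip: conj_nat_pow)
    then show ?thesis using inA by blast
  qed
  have norm: "\<exists>r::nat. g \<otimes> a = a [^] r \<otimes> g" if g: "g \<in> carrier G" for g
  proof -
    have "a \<in> A" by (simp add: A_def generate.incl)
    then obtain r :: nat where r: "g \<otimes> a \<otimes> inv g = a [^] r" using nA[OF g] inA by blast
    have "g \<otimes> a = (g \<otimes> a \<otimes> inv g) \<otimes> g" using a g by (simp add: m_assoc)
    then show ?thesis using r by metis
  qed
  define C where "C = {c \<in> carrier G. c \<otimes> a = a \<otimes> c}"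
  have comm: "c \<otimes> a [^] k = a [^] k \<otimes> c" if "c \<in> C" for c and k :: nat
    using that a twisted_power(1)[of a c 1 k] by (simp add: C_def)
  have C: "subgroup C G"
  proof (rule subgroupI)
    show "inv c \<in> C" if "c \<in> C" for c
    proof -
      have c: "c \<in> carrier G" "c \<otimes> a = a \<otimes> c" using that C_def by auto
      have "inv c \<otimes> a = inv c \<otimes> (a \<otimes> c) \<otimes> inv c" using a c(1) by (simp add: m_assoc)
      also have "\<dots> = inv c \<otimes> (c \<otimes> a) \<otimes> inv c" by (simp add: c)
      also have "\<dots> = a \<otimes> inv c" using a c(1) by (simp flip: m_assoc)
      finally show ?thesis using c by (simp add: C_def)
    qed
    show "c \<otimes> d \<in> C" if "c \<in> C" "d \<in> C" for c d
    proof -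
      have cd: "c \<in> carrier G" "d \<in> carrier G" "c \<otimes> a = a \<otimes> c" "d \<otimes> a = a \<otimes> d"
        using that C_def by auto
      have "c \<otimes> d \<otimes> a = c \<otimes> a \<otimes> d" using a cd(1,2,4) by (simp add: m_assoc)
      also have "\<dots> = a \<otimes> (c \<otimes> d)" using a cd(1-3) by (simp add: m_assoc)
      finally show ?thesis using cd by (simp add: C_def)
    qed
  qed (use a in \<open>auto simp: C_def\<close>)
  have AC: "A \<subseteq> C"
  proof
    fix x assume "x \<in> A"
    then obtain k :: nat where "x = a [^] k" using inA by blast
    then show "x \<in> C" using a nat_pow_Suc2[of a k] by (simp add: C_def)
  qed
  have nC: "g \<otimes> c \<otimes> inv g \<in> C" if g: "g \<in> carrier G" and c: "c \<in> C" for g c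
  proof -
    have cc: "c \<in> carrier G" using c C_def by simp
    obtain r :: nat where r: "inv g \<otimes> a = a [^] r \<otimes> inv g" using norm g by blast
    have "g \<otimes> c \<otimes> inv g \<otimes> a = g \<otimes> (c \<otimes> a [^] r) \<otimes> inv g" using g cc a r by (simp add: m_assoc)
    also have "\<dots> = g \<otimes> (a [^] r \<otimes> inv g) \<otimes> g \<otimes> c \<otimes> inv g"
      using g cc a comm[OF c] by (simp add: m_assoc)
    also have "\<dots> = a \<otimes> (g \<otimes> c \<otimes> inv g)"
      unfolding r[symmetric] using g cc a by (simp add: m_assoc flip: m_assoc[of g "inv g"])
    finally show ?thesis using g cc by (simp add: C_def)
  qed
  \<comment> \<open>Otherwise some coset Ac in C is fixed by conjugation, and a power y of c has
    order p modulo A and commutes with a. If y^p lies in <a^p>, then y also inverts a, so a^2 = 1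
    although 4 divides ord a. If a lies in <y^p>, then <y> is normal and larger than A, against
    maximality.\<close>
  have CA: "C = A"
  proof (rule ccontr)
    assume "C \<noteq> A"
    then have "A \<subset> C" using AC by blast
    then obtain c where c: "c \<in> C - A"
      and cfix: "\<And>g. g \<in> carrier G \<Longrightarrow> \<exists>b\<in>A. g \<otimes> c \<otimes> inv g = b \<otimes> c"
      using p_group_fixed_coset[OF p order_eq A C _ nA nC] by blast
    have cc: "c \<in> carrier G" using c C_def by simp
    obtain k where k: "c [^] (p ^ k) \<notin> A" "c [^] (p ^ Suc k) \<in> A"
      using minimal_prime_power[OF A cc] c by blast
    define y where "y = c [^] (p ^ k)"
    have y: "y \<in> carrier G" "y \<notin> A" "y [^] p \<in> A"
      using k cc by (simp_all add: y_def nat_pow_pow mult.commute)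
    have ya: "y \<otimes> a = a \<otimes> y"
    proof -
      have "c [^] (l::nat) \<in> C" for l
        using c C subgroup.one_closed subgroup.m_closed by (induction l) fastforce+
      then show ?thesis by (simp add: C_def y_def)
    qed
    show False
    proof (rule pow_p_cases[OF a(1) y(1)])
      show "y [^] p \<in> generate G {a}" using y A_def by simp
    next
      fix j assume "y [^] p = a [^] (p * j)"
      then have "y \<otimes> a = inv a \<otimes> y" "4 dvd ord a"
        using inverting_of_normalizing[of a y j 1] a y A_def ya by auto
      then have "a = inv a" "4 dvd ord a" using ya a y by auto
      then have "a [^] (2::nat) = \<one>" using a by (metis nat_pow_Suc nat_pow_0 l_one numeral_2_eq_2 r_inv)
      then have "ord a dvd 2" using a by (simp add: pow_eq_id)
      then show False using \<open>4 dvd ord a\<close> by (auto dest: dvd_trans)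
    next
      fix t assume t: "a = y [^] (p * t)"
      have ay: "a \<in> generate G {y}" using t in_gen y by blast
      then have Ay: "A \<subseteq> generate G {y}" unfolding A_def using generate_singleton_subset y by blast
      have suby: "subgroup (generate G {y}) G" using y by (simp add: generate_is_subgroup)
      have yy: "y \<in> generate G {y}" by (simp add: generate.incl)
      \<comment> \<open>As g c g^-1 = b c with b in A commuting with c, conjugation multiplies y =
        c^(p^k) by b^(p^k), which lies in A and so in <y>.\<close>
      have "g \<otimes> y \<otimes> inv g \<in> generate G {y}" if g: "g \<in> carrier G" for g
      proof -
        obtain b where b: "b \<in> A" "g \<otimes> c \<otimes> inv g = b \<otimes> c" using cfix g by blast
        obtain l :: nat where l: "b = a [^] l" using b inA by blast
        have "b \<otimes> c = c \<otimes> b" using comm l c by simp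
        then have "(b \<otimes> c) [^] (p ^ k) = b [^] (p ^ k) \<otimes> y"
          unfolding y_def using b cc Ac by (intro pow_mult_distrib) auto
        then have "g \<otimes> y \<otimes> inv g = b [^] (p ^ k) \<otimes> y"
          using b g cc by (simp add: y_def flip: conj_nat_pow)
        moreover have "b [^] (p ^ k) \<in> A" using l a inA by (metis nat_pow_pow)
        ultimately show ?thesis using Ay yy subgroup.m_closed[OF suby] by auto
      qed
      moreover have "y \<noteq> \<one>" using y subgroup.one_closed[OF A] by blast
      ultimately have "y \<in> N" using y by (simp add: N_def)
      then have "ord y \<le> ord a" using max by blast
      moreover have "A \<subset> generate G {y}" using Ay yy y by blast
      then have "card A < card (generate G {y})"
        using psubset_card_mono fin subgroup.subset[OF suby] finite_subset by metis
      ultimately show False using a y generate_pow_card A_def by simp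
    qed
  qed
  have outside: "p = 2 \<and> w \<otimes> a = inv a \<otimes> w \<and> w \<otimes> w = z \<and> 4 dvd ord a"
    if w: "w \<in> carrier G" "w \<notin> A" for w
  proof -
    obtain k where k: "w [^] (p ^ k) \<notin> A" "w [^] (p ^ Suc k) \<in> A"
      using minimal_prime_power[OF A w] by blast
    define y where "y = w [^] (p ^ k)"
    have y: "y \<in> carrier G" "y \<notin> A" "y [^] p \<in> A"
      using k w by (simp_all add: y_def nat_pow_pow mult.commute)
    obtain r :: nat where r: "y \<otimes> a = a [^] r \<otimes> y" using norm y by blast
    have inv: "p = 2 \<and> y \<otimes> a = inv a \<otimes> y \<and> y \<otimes> y = z \<and> 4 dvd ord a"
    proof (rule pow_p_cases[OF a(1) y(1)])
      show "y [^] p \<in> generate G {a}" using y A_def by simp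
    next
      fix j assume "y [^] p = a [^] (p * j)"
      then show ?thesis using inverting_of_normalizing a y r A_def by blast
    next
      fix t assume t: "a = y [^] (p * t)"
      \<comment> \<open>Here a is a power of y, so y would lie in C = A.\<close>
      have "y \<otimes> a = a \<otimes> y" unfolding t using y nat_pow_Suc2[of y "p * t"] by simp
      then show ?thesis using y CA unfolding C_def by blast
    qed
    txt \<open>Inversion of a cyclic group of order divisible by 4 is not the square of an automorphism,
      as -1 is not a square modulo 4; hence \<open>k = 0\<close>.\<close>
    show ?thesis
    proof (cases k)
      case 0
      then show ?thesis using inv w by (simp add: y_def)
    next
      case (Suc l)
      define v where "v = w [^] (p ^ l)"
      have v: "v \<in> carrier G" using w v_def by simp
      have yv: "y = v \<otimes> v"
        using w Suc inv by (simp add: y_def v_def nat_pow_mult mult_2)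
      obtain s :: nat where s: "v \<otimes> a = a [^] s \<otimes> v" using norm v by blast
      have "y \<otimes> a = v \<otimes> (v \<otimes> a)" using v a yv by (simp add: m_assoc)
      also have "\<dots> = (v \<otimes> a [^] s) \<otimes> v" using v a s by (simp add: m_assoc)
      also have "\<dots> = a [^] (s * s) \<otimes> v \<otimes> v" using twisted_power(1)[OF a(1) v s] by simp
      finally have "a [^] (s * s) \<otimes> y = inv a \<otimes> y" using inv v a yv by (simp add: m_assoc)
      then have "a [^] (s * s) = inv a" using y a by simp
      then have "a [^] Suc (s * s) = \<one>" using a by simp
      then have "ord a dvd Suc (s * s)" using pow_eq_id a by blast
      then have "4 dvd Suc (s * s)" using inv dvd_trans by blast
      then show ?thesis using not_4_dvd_Suc_square by blast
    qed
  qed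
  show ?thesis
  proof (cases "A = carrier G")
    case True
    have "subgroup_generated G {a} = G"
      using a True by (simp add: subgroup_generated_def A_def)
    then show ?thesis using a cyclic_group_def by blast
  next
    case False
    then obtain w where w: "w \<in> carrier G" "w \<notin> A" using Ac by blast
    note W = outside[OF w]
    obtain m where m: "ord a = 2 ^ m" using ord_prime_power[OF a(1)] W by auto
    have "m \<ge> 2"
    proof -
      have "(2::nat) ^ 2 dvd 2 ^ m" using W m by simp
      then show ?thesis by (rule power_dvd_imp_le) simp
    qed
    \<comment> \<open>Two inverting elements differ by a centralizing one: v w^-1 lies in C =
      A.\<close>
    have "v \<in> A #> w" if v: "v \<in> carrier G" "v \<notin> A" for v
    proof -
      have "v \<otimes> inv w \<otimes> a = v \<otimes> inv a \<otimes> inv w"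
        using inverting_element(3)[OF a(1) w(1)] W v w a by (simp add: m_assoc)
      also have "\<dots> = a \<otimes> (v \<otimes> inv w)"
        using inverting_element(1)[OF a(1) v(1)] outside[OF v] v w a by (simp add: m_assoc)
      finally have "v \<otimes> inv w \<otimes> a = a \<otimes> (v \<otimes> inv w)" .
      then have "v \<otimes> inv w \<in> A" using v w CA by (auto simp: C_def)
      moreover have "v = v \<otimes> inv w \<otimes> w" using v w by (simp add: m_assoc)
      ultimately show ?thesis unfolding r_coset_def by blast
    qed
    then have "carrier G \<subseteq> A \<union> (A #> w)" by blast
    moreover have "A \<union> (A #> w) \<subseteq> carrier G" using Ac r_coset_subset_G[OF Ac w(1)] by simp
    ultimately have un: "carrier G = A \<union> (A #> w)" by (rule equalityI)
    have "A \<inter> (A #> w) = {}"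
    proof -
      have "A #> w \<in> rcosets A" "A \<in> rcosets A"
        using rcosetsI[OF Ac w(1)] rcosetsI[OF Ac one_closed] coset_mult_one[OF Ac] by simp_all
      moreover have "A #> w \<noteq> A" using coset_join1[OF _ w(1) A] w by blast
      ultimately show ?thesis using rcos_disjoint[OF A] by (auto simp: pairwise_def disjnt_def)
    qed
    moreover have "card (A #> w) = card A"
      using card_rcosets_equal[OF _ Ac] rcosetsI[OF Ac w(1)] by metis
    moreover have "finite A" "finite (A #> w)" using fin un by (metis finite_Un)+
    ultimately have "order G = card A + card A"
      unfolding order_def un by (simp add: card_Un_disjoint)
    moreover have "card A = 2 ^ m" using generate_pow_card[OF a(1)] m A_def by simp
    ultimately have ordG: "order G = 2 ^ Suc m" by simp
    have gen: "generate G {a, w} = carrier G"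
    proof
      show "generate G {a, w} \<subseteq> carrier G" using a w by (intro generate_incl) auto
      have "subgroup (generate G {a, w}) G" using a w by (intro generate_is_subgroup) auto
      moreover have "A \<subseteq> generate G {a, w}" unfolding A_def by (rule mono_generate) auto
      moreover have "w \<in> generate G {a, w}" by (simp add: generate.incl)
      ultimately show "carrier G \<subseteq> generate G {a, w}"
        unfolding un by (auto simp: r_coset_def subset_iff subgroup.m_closed)
    qed
    \<comment> \<open>u is the involution of <a>, so it equals z = w^2. This is the defining
      relation for the square, with n = m + 1; \<open>m \<ge> 2\<close> gives
      \<open>3 \<le> n\<close>.\<close>
    define u where "u = a [^] ((2::nat) ^ (m - 1))"
    have "u \<otimes> u = a [^] ((2::nat) ^ m)"
      using a \<open>m \<ge> 2\<close> by (cases m) (simp_all add: u_def nat_pow_mult mult_2)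
    then have "u \<otimes> u = \<one>" using a pow_ord_eq_1 m by metis
    moreover have "u \<noteq> \<one>"
    proof
      assume "u = \<one>"
      then have "(2::nat) ^ m dvd 2 ^ (m - 1)" using a m by (simp add: u_def pow_eq_id)
      then have "m \<le> m - 1" by (rule power_dvd_imp_le) simp
      then show False using \<open>m \<ge> 2\<close> by simp
    qed
    moreover have "u \<in> carrier G" using a by (simp add: u_def)
    ultimately have "u = z" using involution_eq W by blast
    then have "w [^] (2::nat) = u"
      using W w by (simp add: numeral_2_eq_2)
    moreover have "inv w \<otimes> a \<otimes> w = inv a"
      using inverting_element(2) a w W by blast
    moreover have "a [^] ((2::nat) ^ m) = \<one>" using a m pow_ord_eq_1 by metis
    ultimately have "generalized_quaternion_group G"
      unfolding generalized_quaternion_group_def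
      using ordG gen a w \<open>m \<ge> 2\<close> is_group
      by (intro conjI exI[of _ "Suc m"] exI[of _ a] exI[of _ w]) (simp_all add: u_def)
    then show ?thesis by blast
  qed
qed

end

section \<open>Central elements, cyclic pairs and quaternion groups\<close>

context group
begin

text \<open>Cauchy's theorem: \<open>sylow_thm\<close> with exponent 1 provides a subgroup of order
  p.\<close>

lemma exists_prime_order:
  assumes "prime p" "finite (carrier G)" "p dvd order G"
  shows "\<exists>x\<in>carrier G. x \<noteq> \<one> \<and> x [^] p = \<one>"
proof -
  obtain m where "order G = p ^ 1 * m" using assms(3) by auto
  then obtain H where H: "subgroup H G" "card H = p" using sylow_thm[of p G 1 m] assms is_group by auto
  have "H \<noteq> {\<one>}" using H assms(1) by auto
  then obtain x where x: "x \<in> H" "x \<noteq> \<one>" using subgroup.one_closed[OF H(1)] by blast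
  interpret H: group "G\<lparr>carrier := H\<rparr>" using H subgroup_imp_group by blast
  have "x [^] p = \<one>"
    using H.pow_order_eq_1[of x] x H by (simp add: order_def flip: nat_pow_consistent)
  then show ?thesis using x subgroup.subset[OF H(1)] by blast
qed

lemma ord_eq_primeI:
  assumes "x \<in> carrier G" "x \<noteq> \<one>" "x [^] p = \<one>" "prime p"
  shows "ord x = p"
  using assms by (metis ord_eq_1 pow_eq_id prime_nat_iff)

lemma ord_consistent:
  assumes "subgroup H G"
  shows "group.ord (G\<lparr>carrier := H\<rparr>) x = ord x"
  using group.ord_def[OF subgroup_imp_group[OF assms]]
  by (simp add: ord_def flip: nat_pow_consistent)

lemma subgroup_group_center: "subgroup (group_center G) G"
proof (rule subgroupI)
  show "inv z \<in> group_center G" if "z \<in> group_center G" for z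
  proof -
    have z: "z \<in> carrier G" "\<And>g. g \<in> carrier G \<Longrightarrow> z \<otimes> g = g \<otimes> z"
      using that by (auto simp: group_center_def)
    have "inv z \<otimes> g = g \<otimes> inv z" if g: "g \<in> carrier G" for g
    proof -
      have "inv z \<otimes> g = inv z \<otimes> (g \<otimes> z) \<otimes> inv z" using z(1) g by (simp add: m_assoc)
      also have "\<dots> = g \<otimes> inv z" using z(1) g unfolding z(2)[OF g, symmetric] by (simp flip: m_assoc)
      finally show ?thesis .
    qed
    then show ?thesis using z(1) by (simp add: group_center_def)
  qed
  show "y \<otimes> z \<in> group_center G" if "y \<in> group_center G" "z \<in> group_center G" for y z
  proof -
    have yz: "y \<in> carrier G" "z \<in> carrier G"
      "\<And>g. g \<in> carrier G \<Longrightarrow> y \<otimes> g = g \<otimes> y" "\<And>g. g \<in> carrier G \<Longrightarrow> z \<otimes> g = g \<otimes> z"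
      using that by (auto simp: group_center_def)
    have "y \<otimes> z \<otimes> g = g \<otimes> (y \<otimes> z)" if g: "g \<in> carrier G" for g
    proof -
      have "y \<otimes> z \<otimes> g = y \<otimes> g \<otimes> z" using yz(1,2) yz(4)[OF g] g by (simp add: m_assoc)
      then show ?thesis using yz(1,2) yz(3)[OF g] g by (simp add: m_assoc)
    qed
    then show ?thesis using yz(1,2) by (simp add: group_center_def)
  qed
qed (auto simp: group_center_def intro!: exI[of _ \<one>])

lemma central_conj: "z \<in> group_center G \<Longrightarrow> g \<in> carrier G \<Longrightarrow> g \<otimes> z \<otimes> inv g = z"
proof -
  assume z: "z \<in> group_center G" and g: "g \<in> carrier G"
  then have "z \<in> carrier G" "g \<otimes> z = z \<otimes> g" by (auto simp: group_center_def)
  then show ?thesis using g by (simp add: m_assoc)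
qed

text \<open>A finite group is not the union of the conjugates of a proper subgroup; here the subgroup
  is the centralizer of \<open>x\<close>.\<close>

lemma central_if_conjugates_commute:
  assumes fin: "finite (carrier G)" and x: "x \<in> carrier G"
    and comm: "\<And>y. y \<in> carrier G \<Longrightarrow>
      \<exists>g\<in>carrier G. (g \<otimes> x \<otimes> inv g) \<otimes> y = y \<otimes> (g \<otimes> x \<otimes> inv g)"
  shows "x \<in> group_center G"
proof -
  define \<phi> where "\<phi> = (\<lambda>g. \<lambda>h \<in> carrier G. g \<otimes> h \<otimes> inv g)"
  interpret conj: group_action G "carrier G" \<phi>
    unfolding \<phi>_def by (rule action_by_conjugation)
  define K where "K = orbit G \<phi> x"
  \<comment> \<open>Under conjugation the stabilizer of k is its centralizer; for k in the class K
    of x it has order |G| / |K|.\<close>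
  define S where "S k = stabilizer G \<phi> k" for k
  have Kdef: "K = {g \<otimes> x \<otimes> inv g | g. g \<in> carrier G}"
    using x by (simp add: K_def orbit_def \<phi>_def)
  have Kc: "K \<subseteq> carrier G" using x by (auto simp: Kdef)
  have finK: "finite K" using Kc fin finite_subset by blast
  have xK: "x \<in> K" using conj.orbit_refl[OF x] by (simp add: K_def)
  have cardS: "card (S k) * card K = order G" if k: "k \<in> K" for k
  proof -
    have "orbit G \<phi> k = K"
      using conj.disjoint_union[of "orbit G \<phi> k" K] conj.orbit_refl[of k] k Kc x
      by (auto simp: orbits_def K_def)
    then show ?thesis using conj.orbit_stabilizer_theorem[of k] k Kc by (auto simp: S_def mult.commute)
  qed
  have SI: "y \<in> S k" if "k \<in> K" "y \<in> carrier G" "k \<otimes> y = y \<otimes> k" for k y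
  proof -
    have kc: "k \<in> carrier G" using that Kc by blast
    then have "y \<otimes> k \<otimes> inv y = k" unfolding that(3)[symmetric] using that(2) by (simp add: m_assoc)
    then show ?thesis using kc that(2) by (simp add: S_def stabilizer_def \<phi>_def)
  qed
  have Sc: "S k \<subseteq> carrier G" for k by (auto simp: S_def stabilizer_def)
  have oneS: "\<one> \<in> S k" if "k \<in> K" for k using SI[OF that] that Kc by auto
  have K0: "card K > 0" using xK finK card_gt_0_iff by blast
  define s where "s = card (S x)"
  have s: "card (S k) = s" if "k \<in> K" for k
    using cardS[OF that] cardS[OF xK] K0 s_def by (metis mult_right_cancel less_irrefl)
  have s0: "s > 0" using cardS[OF xK] fin order_gt_0_iff_finite s_def by (metis gr0I mult_is_0 less_irrefl)
  \<comment> \<open>The identity lies in every centralizer, and removing it makes the count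
    decisive: |G| - 1 <= |K| (s - 1) = |G| - |K|, so |K| = 1.\<close>
  have "carrier G - {\<one>} \<subseteq> (\<Union>k\<in>K. S k - {\<one>})"
  proof
    fix y assume y: "y \<in> carrier G - {\<one>}"
    then obtain g where g: "g \<in> carrier G" "(g \<otimes> x \<otimes> inv g) \<otimes> y = y \<otimes> (g \<otimes> x \<otimes> inv g)"
      using comm by blast
    then have "g \<otimes> x \<otimes> inv g \<in> K" by (auto simp: Kdef)
    then show "y \<in> (\<Union>k\<in>K. S k - {\<one>})" using SI g y by blast
  qed
  moreover have finS: "finite (S k)" for k using Sc fin finite_subset by blast
  ultimately have "card (carrier G - {\<one>}) \<le> card (\<Union>k\<in>K. S k - {\<one>})"
    using finK by (intro card_mono) auto
  also have "\<dots> \<le> (\<Sum>k\<in>K. card (S k - {\<one>}))" by (rule card_UN_le[OF finK])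
  also have "\<dots> = (\<Sum>k\<in>K. s - 1)"
    using oneS s finS by (intro sum.cong) (auto simp: card_Diff_singleton)
  also have "\<dots> = card K * s - card K" by (simp add: diff_mult_distrib2)
  also have "card K * s = order G" using cardS[OF xK] by (simp add: s_def mult.commute)
  finally have le: "order G - 1 \<le> order G - card K" by (simp add: order_def card_Diff_singleton)
  moreover have "card K \<le> order G" using cardS[OF xK] s0 by (metis s_def le_add1 mult_Suc gr0_implies_Suc)
  ultimately have "card K = 1" using K0 by linarith
  then have "K = {x}" using xK by (metis card_1_singletonE singletonD)
  then have "g \<otimes> x \<otimes> inv g = x" if "g \<in> carrier G" for g using that Kdef by blast
  then have "g \<otimes> x = x \<otimes> g" if "g \<in> carrier G" for g using that x by (metis inv_solve_right m_closed)
  then show ?thesis using x by (simp add: group_center_def)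
qed

lemma cyclic_pair_generator:
  assumes "x \<in> carrier G" "y \<in> carrier G" "cyclic_group (subgroup_generated G {x, y})"
  shows "\<exists>c\<in>carrier G. x \<in> generate G {c} \<and> y \<in> generate G {c}"
proof -
  define H where "H = generate G {x, y}"
  have H: "subgroup H G" using assms by (simp add: H_def generate_is_subgroup)
  have eq: "subgroup_generated G {x, y} = G\<lparr>carrier := H\<rparr>"
    using assms by (simp add: subgroup_generated_def H_def)
  obtain c where c: "c \<in> H" "subgroup_generated (G\<lparr>carrier := H\<rparr>) {c} = G\<lparr>carrier := H\<rparr>"
    using assms(3) unfolding eq cyclic_group_def by auto
  have "H = carrier (subgroup_generated (G\<lparr>carrier := H\<rparr>) {c})" by (simp add: c)
  also have "\<dots> = generate G {c}"
    using c(1) generate_consistent[OF _ H, of "{c}"] by (simp add: carrier_subgroup_generated)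
  finally have "H = generate G {c}" .
  moreover have "x \<in> H" "y \<in> H" by (auto simp: H_def generate.incl)
  ultimately show ?thesis using c H subgroup.subset by blast
qed

lemma cyclic_pairI:
  assumes "x \<in> carrier G" "y \<in> carrier G" "c \<in> generate G {x, y}"
    and "x \<in> generate G {c}" "y \<in> generate G {c}"
  shows "cyclic_group (subgroup_generated G {x, y})"
proof -
  have xy: "subgroup (generate G {x, y}) G" using assms by (simp add: generate_is_subgroup)
  then have c: "c \<in> carrier G" using assms subgroup.subset by blast
  have "generate G {x, y} = generate G {c}"
    using assms c xy generate_is_subgroup[of "{c}"] by (intro equalityI generate_subgroup_incl) auto
  then have "subgroup_generated G {x, y} = subgroup_generated G {c}"
    using assms c by (simp add: subgroup_generated_def)
  then show ?thesis using cyclic_group_generated by simp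
qed

text \<open>The witness is the generator x of the presentation. Every element is some x^i or x^i y,
  and (x^i y)^2 = y^2 = x^(2^(n-2)) is not 1: otherwise <x> would have at most 2^(n-2) elements and
  the group at most 2^(n-1).\<close>

lemma quaternion_involutions:
  assumes fin: "finite (carrier G)" and Q: "generalized_quaternion_group G"
  shows "\<exists>a\<in>carrier G. \<forall>y\<in>carrier G. y [^] (2::nat) = \<one> \<longrightarrow> y \<in> generate G {a}"
proof -
  obtain n x y where n: "3 \<le> n" "order G = 2 ^ n" and x: "x \<in> carrier G" and y: "y \<in> carrier G"
    and gen: "generate G {x, y} = carrier G"
    and xn: "x [^] ((2::nat) ^ (n - 1)) = \<one>" and y2: "y [^] (2::nat) = x [^] ((2::nat) ^ (n - 2))"
    and yx: "inv y \<otimes> x \<otimes> y = inv x"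
    using Q unfolding generalized_quaternion_group_def by blast
  define X where "X = generate G {x}"
  have X: "subgroup X G" using x by (simp add: X_def generate_is_subgroup)
  have Xc: "X \<subseteq> carrier G" using X subgroup.subset by blast
  note Xcl = subgroup.m_closed[OF X] subgroup.m_inv_closed[OF X] subgroup.one_closed[OF X]
  have inX: "b \<in> X \<longleftrightarrow> (\<exists>k::nat. b = x [^] k)" for b
    unfolding X_def by (rule in_generate_singleton_iff[OF fin x])
  have yy: "y \<otimes> y \<in> X" using y y2 inX by (auto simp: numeral_2_eq_2)
  have yb: "y \<otimes> b = inv b \<otimes> y" if b: "b \<in> X" for b
  proof -
    obtain k :: nat where k: "b = x [^] k" using b inX by blast
    have "inv y \<otimes> b \<otimes> y = inv b"
      using conj_nat_pow[of "inv y" x k] x y k yx nat_pow_inv[OF x, of k] by simp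
    then have "inv (inv y \<otimes> b \<otimes> y) = b" using k x by simp
    then have "inv y \<otimes> inv b \<otimes> y = b" using k x y by (simp add: inv_mult_group m_assoc)
    then have "y \<otimes> b = y \<otimes> (inv y \<otimes> inv b \<otimes> y)" by simp
    then show ?thesis using k x y by (simp flip: m_assoc)
  qed
  \<comment> \<open>S is closed under products because y b = b^-1 y for b in X and y^2 lies in X; it
    contains x, y and their inverses, so it is the whole group.\<close>
  define S where "S = X \<union> (X #> y)"
  have XS: "b \<in> S" if "b \<in> X" for b using that by (simp add: S_def)
  have mult_y: "b \<otimes> y \<in> S" if "b \<in> X" for b using that by (auto simp: S_def r_coset_def)
  have cl: "u \<otimes> v \<in> S" if u: "u \<in> S" and v: "v \<in> S" for u v
  proof -
    have "(b \<otimes> y) \<otimes> b' = (b \<otimes> inv b') \<otimes> y" "(b \<otimes> y) \<otimes> (b' \<otimes> y) = (b \<otimes> inv b') \<otimes> (y \<otimes> y)"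
      "b \<otimes> (b' \<otimes> y) = (b \<otimes> b') \<otimes> y"
      if b: "b \<in> X" and b': "b' \<in> X" for b b'
    proof -
      have c: "b \<in> carrier G" "b' \<in> carrier G" using b b' Xc by auto
      show "(b \<otimes> y) \<otimes> b' = (b \<otimes> inv b') \<otimes> y" using yb[OF b'] c y by (simp add: m_assoc)
      then show "(b \<otimes> y) \<otimes> (b' \<otimes> y) = (b \<otimes> inv b') \<otimes> (y \<otimes> y)"
        using c y by (simp flip: m_assoc)
      show "b \<otimes> (b' \<otimes> y) = (b \<otimes> b') \<otimes> y" using c y by (simp add: m_assoc)
    qed
    then have "b \<otimes> y \<otimes> b' \<in> S" "b \<otimes> y \<otimes> (b' \<otimes> y) \<in> S" "b \<otimes> (b' \<otimes> y) \<in> S" "b \<otimes> b' \<in> S"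
      if "b \<in> X" "b' \<in> X" for b b'
      using that Xcl yy mult_y XS by simp_all
    moreover have "u \<in> X \<or> (\<exists>b\<in>X. u = b \<otimes> y)" "v \<in> X \<or> (\<exists>b\<in>X. v = b \<otimes> y)"
      using u v unfolding S_def r_coset_def by auto
    ultimately show ?thesis by blast
  qed
  have "g \<in> S" if "g \<in> generate G {x, y}" for g
    using that
  proof (induction rule: generate.induct)
    case one
    show ?case using Xcl by (simp add: S_def)
  next
    case (incl h)
    have "x \<in> X" by (simp add: X_def generate.incl)
    then show ?case using incl mult_y[of \<one>] Xcl y by (auto simp: S_def)
  next
    case (inv h)
    have "inv x \<in> X" by (simp add: X_def generate.inv)
    moreover have "inv y = inv (y \<otimes> y) \<otimes> y" using y by (simp add: inv_mult_group m_assoc)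
    then have "inv y \<in> S" using mult_y Xcl yy by metis
    ultimately show ?case using inv by (auto simp: S_def)
  next
    case (eng h1 h2)
    then show ?case using cl by blast
  qed
  then have GS: "carrier G = X \<union> (X #> y)" using gen S_def r_coset_subset_G[OF Xc y] Xc by blast
  \<comment> \<open>The assumptions are contradictory, by a count of elements; membership in X
    follows from the contradiction.\<close>
  have "b \<otimes> y \<in> X" if b: "b \<in> X" "(b \<otimes> y) [^] (2::nat) = \<one>" for b
  proof -
    have bc: "b \<in> carrier G" using b Xc by blast
    have "(b \<otimes> y) \<otimes> (b \<otimes> y) = b \<otimes> (y \<otimes> b) \<otimes> y" using bc y by (simp add: m_assoc)
    also have "\<dots> = y \<otimes> y" using yb[OF b(1)] bc y by (simp flip: m_assoc)
    finally have "y \<otimes> y = \<one>" using b bc y by (simp add: numeral_2_eq_2)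
    then have "x [^] ((2::nat) ^ (n - 2)) = \<one>" using y2 y by (simp add: numeral_2_eq_2)
    then have "ord x dvd 2 ^ (n - 2)" using pow_eq_id x by blast
    then have "ord x \<le> 2 ^ (n - 2)" by (rule dvd_imp_le) simp
    then have "card X \<le> 2 ^ (n - 2)" using generate_pow_card[OF x] X_def by simp
    moreover have "card (X #> y) = card X"
      using card_rcosets_equal[OF _ Xc] rcosetsI[OF Xc y] by metis
    then have "card (carrier G) \<le> card X + card X" unfolding GS using card_Un_le by metis
    ultimately have "(2::nat) ^ n \<le> 2 * 2 ^ (n - 2)" using n by (simp add: order_def)
    then have "(2::nat) ^ n \<le> 2 ^ (n - 1)" using n(1)
      by (metis Suc_diff_le diff_Suc_Suc eval_nat_numeral(3) le_trans nat_le_linear numeral_2_eq_2 one_add_one plus_1_eq_Suc power_Suc Suc_leD)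
    then show ?thesis using n(1) by simp
  qed
  then show ?thesis using x unfolding GS r_coset_def X_def by auto
qed

end

section \<open>Universal vertices\<close>

context group
begin

section \<open>The Sylow condition and central elements of prime order\<close>

definition central_unique_prime :: "nat \<Rightarrow> 'a \<Rightarrow> bool" where
  "central_unique_prime p z \<longleftrightarrow> prime p \<and> z \<in> group_center G \<and> ord z = p \<and>
     (\<forall>y\<in>carrier G. y [^] p = \<one> \<longrightarrow> y \<in> generate G {z})"

lemma ord_dvd_card_subgroup:
  assumes "subgroup H G" "x \<in> H"
  shows "ord x dvd card H"
  using group.ord_dvd_group_order[OF subgroup_imp_group[OF assms(1)], of x] assms
  by (simp add: ord_consistent order_def)

text \<open>A Sylow p-subgroup P is nontrivial, so it contains some y of order p. As y lies in <z>,
  z lies in <y> and hence in P, and uniqueness restricts to P.\<close>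

lemma sylow_if_central_unique_prime:
  assumes fin: "finite (carrier G)" and U: "central_unique_prime p z"
  shows "prime p \<and> p dvd card (group_center G) \<and>
    (\<exists>P. sylow_subgroup p P G \<and>
      (cyclic_group (G\<lparr>carrier := P\<rparr>) \<or> generalized_quaternion_group (G\<lparr>carrier := P\<rparr>)))"
proof -
  have p: "prime p" and zc: "z \<in> group_center G" "ord z = p"
    and uniq: "\<And>y. y \<in> carrier G \<Longrightarrow> y [^] p = \<one> \<Longrightarrow> y \<in> generate G {z}"
    using U by (auto simp: central_unique_prime_def)
  have z: "z \<in> carrier G" using zc by (simp add: group_center_def)
  have zp: "z [^] p = \<one>" using pow_ord_eq_1[OF z] zc by simp
  define n where "n = multiplicity p (order G)"
  have "order G \<noteq> 0" using fin order_gt_0_iff_finite by simp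
  moreover have pG: "p dvd order G" using ord_dvd_group_order[OF z] zc by simp
  ultimately have n0: "n \<noteq> 0" using p by (simp add: n_def prime_multiplicity_gt_zero_iff)
  obtain m where "order G = p ^ n * m" using multiplicity_dvd[of p "order G"] n_def by blast
  then obtain P where P: "subgroup P G" "card P = p ^ n" using sylow_thm[OF p is_group _ fin] by blast
  interpret P: group "G\<lparr>carrier := P\<rparr>" using P subgroup_imp_group by blast
  have Pc: "P \<subseteq> carrier G" using P subgroup.subset by blast
  have "finite P" using Pc fin finite_subset by blast
  then obtain y where y: "y \<in> P" "y \<noteq> \<one>" "y [^] p = \<one>"
    using P.exists_prime_order[OF p] P n0 by (auto simp: order_def dvd_power simp flip: nat_pow_consistent)
  have yc: "y \<in> carrier G" using y Pc by blast
  have "y \<in> generate G {z}" using uniq yc y by blast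
  moreover have "z \<in> generate G {z}" by (simp add: generate.incl)
  ultimately have "z \<in> generate G {y}"
    using generate_prime_ord_eq[OF fin z p, of y z] ord_eq_primeI[OF yc y(2,3) p] zp by blast
  then have zP: "z \<in> P" using generate_subgroup_incl[OF _ P(1), of "{y}"] y by blast
  have "unique_order_p_group (G\<lparr>carrier := P\<rparr>) p n z"
  proof unfold_locales
    show "order (G\<lparr>carrier := P\<rparr>) = p ^ n" using P by (simp add: order_def)
    show "P.ord z = p" using ord_consistent P zc by simp
    fix y assume "y \<in> carrier (G\<lparr>carrier := P\<rparr>)" "y [^]\<^bsub>G\<lparr>carrier := P\<rparr>\<^esub> p = \<one>\<^bsub>G\<lparr>carrier := P\<rparr>\<^esub>"
    then have "y \<in> generate G {z}" using uniq Pc by (auto simp flip: nat_pow_consistent)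
    then show "y \<in> generate (G\<lparr>carrier := P\<rparr>) {z}"
      using generate_consistent[OF _ P(1), of "{z}"] zP by simp
  qed (use p zP in simp_all)
  then have "cyclic_group (G\<lparr>carrier := P\<rparr>) \<or> generalized_quaternion_group (G\<lparr>carrier := P\<rparr>)"
    by (rule unique_order_p_group.cyclic_or_generalized_quaternion)
  moreover have "sylow_subgroup p P G" using p P by (simp add: sylow_subgroup_def n_def)
  moreover have "p dvd card (group_center G)"
    using ord_dvd_card_subgroup[OF subgroup_group_center zc(1)] zc by simp
  ultimately show ?thesis using p by blast
qed

text \<open>If y is not trivial, <y> has order p and acts on the right cosets of P, whose number is
  not divisible by p. A fixed coset satisfies P g y = P g, so g y g^-1 lies in P.\<close>

lemma conj_in_sylow:
  assumes fin: "finite (carrier G)" and P: "sylow_subgroup p P G"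
    and y: "y \<in> carrier G" "y [^] p = \<one>"
  shows "\<exists>g\<in>carrier G. g \<otimes> y \<otimes> inv g \<in> P"
proof (cases "y = \<one>")
  case True
  then show ?thesis using P subgroup.one_closed by (intro bexI[of _ \<one>]) (auto simp: sylow_subgroup_def)
next
  case False
  have p: "prime p" and subP: "subgroup P G" and cardP: "card P = p ^ multiplicity p (order G)"
    using P by (auto simp: sylow_subgroup_def)
  have Pc: "P \<subseteq> carrier G" using subP subgroup.subset by blast
  define H where "H = generate G {y}"
  have H: "subgroup H G" using y by (simp add: H_def generate_is_subgroup)
  have Hc: "H \<subseteq> carrier G" using H subgroup.subset by blast
  interpret H: group "G\<lparr>carrier := H\<rparr>" using H subgroup_imp_group by blast
  have ordH: "order (G\<lparr>carrier := H\<rparr>) = p ^ 1"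
    using generate_pow_card[OF y(1)] ord_eq_primeI[OF y(1) False y(2) p] by (simp add: order_def H_def)
  have E: "X \<subseteq> carrier G" if "X \<in> rcosets P" for X
    using that r_coset_subset_G[OF Pc] by (auto simp: RCOSETS_def)
  \<comment> \<open>The inverse turns right multiplication into a left action.\<close>
  have "\<exists>X\<in>rcosets P. \<forall>h\<in>carrier (G\<lparr>carrier := H\<rparr>). X #> inv h = X"
  proof (rule H.p_group_fixed_point[OF p ordH])
    show "finite (rcosets P)" using fin by (simp add: RCOSETS_def)
    show "\<not> p dvd card (rcosets P)"
    proof
      assume "p dvd card (rcosets P)"
      then have "p ^ Suc (multiplicity p (order G)) dvd order G"
        using lagrange[OF subP] cardP by (metis mult_dvd_mono dvd_refl power_Suc)
      moreover have "order G \<noteq> 0" using fin order_gt_0_iff_finite by simp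
      ultimately have "Suc (multiplicity p (order G)) \<le> multiplicity p (order G)"
        using p by (intro multiplicity_geI) auto
      then show False by simp
    qed
  next
    fix h X assume "h \<in> carrier (G\<lparr>carrier := H\<rparr>)" "X \<in> rcosets P"
    then show "X #> inv h \<in> rcosets P"
      using Hc coset_mult_assoc[OF Pc] by (auto simp: RCOSETS_def subset_iff)
  next
    fix X assume "X \<in> rcosets P"
    then show "X #> inv \<one>\<^bsub>G\<lparr>carrier := H\<rparr>\<^esub> = X" using E coset_mult_one by simp
  next
    fix g h X assume "g \<in> carrier (G\<lparr>carrier := H\<rparr>)" "h \<in> carrier (G\<lparr>carrier := H\<rparr>)" "X \<in> rcosets P"
    then show "X #> inv (g \<otimes>\<^bsub>G\<lparr>carrier := H\<rparr>\<^esub> h) = X #> inv h #> inv g"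
      using Hc E coset_mult_assoc by (simp add: inv_mult_group subset_iff)
  qed
  then obtain g where g: "g \<in> carrier G" and fixed: "\<And>h. h \<in> H \<Longrightarrow> P #> g #> inv h = P #> g"
    by (auto simp: RCOSETS_def)
  have "inv y \<in> H" by (simp add: H_def generate.inv)
  then have "P #> g #> y = P #> g" using fixed[of "inv y"] y by simp
  then have "P #> (g \<otimes> y) = P #> g" using coset_mult_assoc[OF Pc] g y by simp
  then have "g \<otimes> y \<in> P #> g" using rcos_self[of "g \<otimes> y" P] g y subP by simp
  then obtain b where b: "b \<in> P" "g \<otimes> y = b \<otimes> g" by (auto simp: r_coset_def)
  then have "g \<otimes> y \<otimes> inv g = b" using g Pc by (simp add: m_assoc subset_iff)
  then show ?thesis using b g by blast
qed

lemma central_unique_prime_if_sylow: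
  assumes fin: "finite (carrier G)" and p: "prime p" "p dvd card (group_center G)"
    and P: "sylow_subgroup p P G"
    and cq: "cyclic_group (G\<lparr>carrier := P\<rparr>) \<or> generalized_quaternion_group (G\<lparr>carrier := P\<rparr>)"
  shows "\<exists>z. central_unique_prime p z"
proof -
  interpret Z: group "G\<lparr>carrier := group_center G\<rparr>"
    using subgroup_group_center subgroup_imp_group by blast
  have "finite (group_center G)" using fin by (simp add: group_center_def)
  then obtain z where zc: "z \<in> group_center G" "z \<noteq> \<one>" "z [^] p = \<one>"
    using Z.exists_prime_order[OF p(1)] p by (auto simp: order_def simp flip: nat_pow_consistent)
  have z: "z \<in> carrier G" using zc by (simp add: group_center_def)
  have ordz: "ord z = p" using ord_eq_primeI z zc p by blast
  have subP: "subgroup P G" and cardP: "card P = p ^ multiplicity p (order G)"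
    using P by (auto simp: sylow_subgroup_def)
  have Pc: "P \<subseteq> carrier G" using subP subgroup.subset by blast
  interpret P: group "G\<lparr>carrier := P\<rparr>" using subP subgroup_imp_group by blast
  \<comment> \<open>Some conjugate of z lies in P, and a central element is its own only
    conjugate.\<close>
  have zP: "z \<in> P" using conj_in_sylow[OF fin P z zc(3)] central_conj[OF zc(1)] by auto
  \<comment> \<open>In both cases one cyclic subgroup of P contains all its elements of order p, z
    among them; so they all lie in <z>.\<close>
  have "\<exists>a\<in>P. \<forall>w\<in>P. w [^] p = \<one> \<longrightarrow> w \<in> generate G {a}"
    using cq
  proof
    assume "cyclic_group (G\<lparr>carrier := P\<rparr>)"
    then obtain a where a: "a \<in> P" "subgroup_generated (G\<lparr>carrier := P\<rparr>) {a} = G\<lparr>carrier := P\<rparr>"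
      by (auto simp: cyclic_group_def)
    have "P = carrier (subgroup_generated (G\<lparr>carrier := P\<rparr>) {a})" by (simp add: a)
    also have "\<dots> = generate G {a}"
      using a(1) generate_consistent[OF _ subP, of "{a}"] by (simp add: carrier_subgroup_generated)
    finally show ?thesis using a by blast
  next
    assume Q: "generalized_quaternion_group (G\<lparr>carrier := P\<rparr>)"
    then obtain n where "card P = 2 ^ n" by (auto simp: generalized_quaternion_group_def order_def)
    moreover have "p dvd card P" using ord_dvd_card_subgroup[OF subP zP] ordz by simp
    ultimately have "p = 2" using p(1) by (metis prime_dvd_power primes_dvd_imp_eq two_is_prime_nat)
    moreover have "finite P" using Pc fin finite_subset by blast
    then obtain a where "a \<in> P" "\<forall>w\<in>P. w [^] (2::nat) = \<one> \<longrightarrow> w \<in> generate (G\<lparr>carrier := P\<rparr>) {a}"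
      using P.quaternion_involutions[OF _ Q] by (auto simp flip: nat_pow_consistent)
    ultimately show ?thesis using generate_consistent[OF _ subP] by auto
  qed
  then obtain a where a: "a \<in> P" "\<And>w. w \<in> P \<Longrightarrow> w [^] p = \<one> \<Longrightarrow> w \<in> generate G {a}" by blast
  have "y \<in> generate G {z}" if y: "y \<in> carrier G" "y [^] p = \<one>" for y
  proof -
    obtain g where g: "g \<in> carrier G" "g \<otimes> y \<otimes> inv g \<in> P" using conj_in_sylow[OF fin P y] by blast
    have "(g \<otimes> y \<otimes> inv g) [^] p = \<one>" using g y by (simp add: conj_nat_pow)
    then have "g \<otimes> y \<otimes> inv g \<in> generate G {z}"
      using generate_prime_ord_eq[OF fin subsetD[OF Pc a(1)] p(1), of z] a(2) g zP zc(3) ordz by blast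
    then obtain k :: nat where k: "g \<otimes> y \<otimes> inv g = z [^] k"
      using in_generate_singleton_iff[OF fin z] by blast
    \<comment> \<open>Conjugating back from P leaves powers of the central z unchanged.\<close>
    have "y = inv g \<otimes> (g \<otimes> y \<otimes> inv g) \<otimes> inv (inv g)"
      using g(1) y by (simp add: m_assoc flip: m_assoc[of "inv g" g])
    also have "\<dots> = (inv g \<otimes> z \<otimes> inv (inv g)) [^] k"
      using g(1) z by (simp only: k conj_nat_pow inv_closed)
    also have "\<dots> = z [^] k" using central_conj[OF zc(1) inv_closed[OF g(1)]] by simp
    finally show ?thesis using in_generate_singleton_iff[OF fin z] by blast
  qed
  then show ?thesis using p zc ordz by (auto simp: central_unique_prime_def)
qed

section \<open>Orbits under inner automorphisms, and universal vertices\<close>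

lemma inner_auto_apply: "x \<in> carrier G \<Longrightarrow> inner_auto G g x = g \<otimes> x \<otimes> inv g"
  by (simp add: inner_auto_def)

text \<open>Elements of A are conjugations, but A may be proper in Inn(G), so the orbit can be
  smaller than the conjugacy class.\<close>

lemma auto_orbit_mem:
  assumes "subgroup A (InnGroup G)" "x \<in> carrier G" "y \<in> auto_orbit A x"
  shows "\<exists>g\<in>carrier G. y = g \<otimes> x \<otimes> inv g"
  using assms subgroup.subset[OF assms(1)]
  by (auto simp: auto_orbit_def InnGroup_def inner_auto_apply subset_iff image_iff) (metis inner_auto_apply)

lemma auto_orbit_refl:
  assumes "subgroup A (InnGroup G)" "x \<in> carrier G"
  shows "x \<in> auto_orbit A x"
proof -
  have "(\<lambda>x\<in>carrier G. x) \<in> A"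
    using subgroup.one_closed[OF assms(1)] by (simp add: InnGroup_def AutoGroup_def BijGroup_def)
  moreover have "x = (\<lambda>x\<in>carrier G. x) x" using assms(2) by simp
  ultimately show ?thesis unfolding auto_orbit_def by blast
qed

lemma auto_orbit_central:
  assumes "subgroup A (InnGroup G)" "z \<in> group_center G"
  shows "auto_orbit A z = {z}"
proof -
  have z: "z \<in> carrier G" using assms by (simp add: group_center_def)
  then show ?thesis
    using auto_orbit_mem[OF assms(1) z] auto_orbit_refl[OF assms(1) z] central_conj[OF assms(2)] by auto
qed

lemma universal_if_central_unique_prime:
  assumes fin: "finite (carrier G)" and A: "subgroup A (InnGroup G)" and U: "central_unique_prime p z"
  shows "universal_vertex (with_proj (automorphic_cyclic_graph G A)) {z}"
proof -
  have p: "prime p" and zc: "z \<in> group_center G" "ord z = p"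
    and uniq: "\<And>y. y \<in> carrier G \<Longrightarrow> y [^] p = \<one> \<Longrightarrow> y \<in> generate G {z}"
    using U by (auto simp: central_unique_prime_def)
  have z: "z \<in> carrier G" using zc by (simp add: group_center_def)
  have z1: "z \<noteq> \<one>" using zc p by auto
  have zp: "z [^] p = \<one>" using pow_ord_eq_1[OF z] zc by simp
  have orb: "auto_orbit A z = {z}" using auto_orbit_central[OF A zc(1)] .
  have cyc: "cyclic_group (subgroup_generated G {z, y})" if y: "y \<in> carrier G" for y
  proof -
    have sub: "subgroup (generate G {z, y}) G" using z y by (simp add: generate_is_subgroup)
    have mem: "z \<in> generate G {z, y}" "y \<in> generate G {z, y}" by (auto simp: generate.incl)
    have ord0: "ord y > 0" using ord_ge_1[OF fin y] by simp
    show ?thesis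
    proof (cases "p dvd ord y")
      case True
      then obtain k where k: "ord y = k * p" by (metis dvd_def mult.commute)
      then have "k \<noteq> 0" using ord0 by auto
      \<comment> \<open>This power of y has order p and generates the same subgroup as z, so z lies
        in <y>.\<close>
      define w where "w = y [^] k"
      have w: "w \<in> carrier G" "ord w = p"
        using y k \<open>k \<noteq> 0\<close> by (simp_all add: w_def ord_pow)
      have "w [^] p = \<one>" using w pow_ord_eq_1 by metis
      then have "w \<in> generate G {z}" using uniq w by blast
      moreover have "z \<in> generate G {z}" by (simp add: generate.incl)
      ultimately have "z \<in> generate G {w}" using generate_prime_ord_eq[OF fin z p] w zp by blast
      moreover have "w \<in> generate G {y}" using in_generate_singleton_iff[OF fin y] w_def by blast
      ultimately have "z \<in> generate G {y}" using generate_singleton_subset y by blast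
      then show ?thesis using cyclic_pairI[of z y y] z y mem by (simp add: generate.incl)
    next
      case False
      define c where "c = z \<otimes> y"
      have c: "c \<in> carrier G" using z y c_def by simp
      have cz: "z \<otimes> y = y \<otimes> z" using zc y by (auto simp: group_center_def)
      have "coprime (ord y) p" using False p prime_imp_coprime coprime_commute by metis
      \<comment> \<open>Raising to the power ord y * t kills y and fixes z; this recovers z, and
        then y, from c.\<close>
      then obtain t where "[ord y * t = 1] (mod p)" using cong_solve_coprime_nat by (metis One_nat_def)
      then have "z [^] (ord y * t) = z [^] (1::nat)" using nat_pow_eq_iff_cong z zc by blast
      then have "z = z [^] (ord y * t)" using z by simp
      moreover have "y [^] (ord y * t) = \<one>" using y by (simp add: pow_eq_id)
      ultimately have "c [^] (ord y * t) = z"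
        using pow_mult_distrib[OF cz z y, of "ord y * t"] z c_def by simp
      then have zgen: "z \<in> generate G {c}" using in_generate_singleton_iff[OF fin c] by metis
      have subc: "subgroup (generate G {c}) G" using c by (simp add: generate_is_subgroup)
      have "c \<in> generate G {c}" by (simp add: generate.incl)
      then have "inv z \<otimes> c \<in> generate G {c}"
        using zgen subgroup.m_closed[OF subc] subgroup.m_inv_closed[OF subc] by blast
      moreover have "inv z \<otimes> c = y" using z y by (simp add: c_def flip: m_assoc)
      moreover have "c \<in> generate G {z, y}" unfolding c_def using mem subgroup.m_closed[OF sub] by blast
      ultimately show ?thesis using cyclic_pairI[of z y c] z y zgen by simp
    qed
  qed
  have "{z} \<rightarrow>\<^bsub>with_proj (automorphic_cyclic_graph G A)\<^esub> v"
    if v: "v \<in> verts (with_proj (automorphic_cyclic_graph G A))" "v \<noteq> {z}" for v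
  proof -
    obtain y where y: "y \<in> carrier G" "y \<noteq> \<one>" "v = auto_orbit A y"
      using v by (auto simp: automorphic_cyclic_graph_def)
    have "({z}, v) \<in> parcs (automorphic_cyclic_graph G A)"
      using y z z1 orb v(2) cyc[OF y(1)] auto_orbit_refl[OF A y(1)]
      by (auto simp: automorphic_cyclic_graph_def)
    then show ?thesis by (auto simp: arcs_ends_def arc_to_ends_def)
  qed
  moreover have "{z} \<in> verts (with_proj (automorphic_cyclic_graph G A))"
    using z z1 orb by (auto simp: automorphic_cyclic_graph_def)
  ultimately show ?thesis by (simp add: universal_vertex_def)
qed

lemma central_unique_prime_if_universal:
  assumes fin: "finite (carrier G)" and A: "subgroup A (InnGroup G)"
    and U: "universal_vertex (with_proj (automorphic_cyclic_graph G A)) X"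
  shows "\<exists>p z. central_unique_prime p z"
proof -
  let ?D = "with_proj (automorphic_cyclic_graph G A)"
  obtain x where x: "x \<in> carrier G" "x \<noteq> \<one>" "X = auto_orbit A x"
    using U by (auto simp: universal_vertex_def automorphic_cyclic_graph_def)
  \<comment> \<open>The graph has no loops, so elements y of the orbit X form a separate
    case.\<close>
  have near: "auto_orbit A y = X \<or> (\<exists>x'\<in>X. \<exists>y'\<in>auto_orbit A y. cyclic_group (subgroup_generated G {x', y'}))"
    if y: "y \<in> carrier G" "y \<noteq> \<one>" for y
  proof (cases "auto_orbit A y = X")
    case False
    moreover have "auto_orbit A y \<in> verts ?D" using y by (auto simp: automorphic_cyclic_graph_def)
    ultimately have "X \<rightarrow>\<^bsub>?D\<^esub> auto_orbit A y" using U by (simp add: universal_vertex_def)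
    then have "(X, auto_orbit A y) \<in> parcs (automorphic_cyclic_graph G A)"
      by (auto simp: arcs_ends_def arc_to_ends_def)
    then show ?thesis by (auto simp: automorphic_cyclic_graph_def Let_def)
  qed simp
  have conj_back: "inv h \<otimes> (h \<otimes> y \<otimes> inv h) \<otimes> inv (inv h) = y" if "h \<in> carrier G" "y \<in> carrier G" for h y
    using that by (simp add: m_assoc flip: m_assoc[of "inv h" h])
  have conj_mult: "h \<otimes> (u \<otimes> v) \<otimes> inv h = (h \<otimes> u \<otimes> inv h) \<otimes> (h \<otimes> v \<otimes> inv h)"
    if "h \<in> carrier G" "u \<in> carrier G" "v \<in> carrier G" for h u v
    using that by (simp add: m_assoc flip: m_assoc[of "inv h" h])
  have "x \<in> group_center G"
  proof (rule central_if_conjugates_commute[OF fin x(1)])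
    fix y assume y: "y \<in> carrier G"
    consider "y = \<one>" | "auto_orbit A y = X" | x' y' where "x' \<in> X" "y' \<in> auto_orbit A y"
      "cyclic_group (subgroup_generated G {x', y'})"
      using near y by blast
    then show "\<exists>g\<in>carrier G. (g \<otimes> x \<otimes> inv g) \<otimes> y = y \<otimes> (g \<otimes> x \<otimes> inv g)"
    proof cases
      case 1
      then show ?thesis using x by (intro bexI[of _ \<one>]) auto
    next
      case 2
      then have "y \<in> auto_orbit A x" using auto_orbit_refl[OF A y] x by simp
      then obtain g where "g \<in> carrier G" "y = g \<otimes> x \<otimes> inv g" using auto_orbit_mem[OF A x(1)] by blast
      then show ?thesis by blast
    next
      case 3
      obtain g where g: "g \<in> carrier G" "x' = g \<otimes> x \<otimes> inv g"
        using 3 x auto_orbit_mem[OF A x(1)] by blast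
      obtain h where h: "h \<in> carrier G" "y' = h \<otimes> y \<otimes> inv h"
        using 3 auto_orbit_mem[OF A y] by blast
      have xy: "x' \<in> carrier G" "y' \<in> carrier G" using g h x y by auto
      then obtain c where c: "c \<in> carrier G" "x' \<in> generate G {c}" "y' \<in> generate G {c}"
        using cyclic_pair_generator 3 by blast
      then obtain i j :: nat where "x' = c [^] i" "y' = c [^] j"
        using in_generate_singleton_iff[OF fin c(1)] by blast
      then have "x' \<otimes> y' = y' \<otimes> x'" using nat_pow_comm[OF c(1)] by simp
      \<comment> \<open>Conjugation by h^-1 takes y' back to y and x' to another conjugate of x, so
        y itself commutes with a conjugate of x.\<close>
      then have "(inv h \<otimes> x' \<otimes> inv (inv h)) \<otimes> (inv h \<otimes> y' \<otimes> inv (inv h))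
          = (inv h \<otimes> y' \<otimes> inv (inv h)) \<otimes> (inv h \<otimes> x' \<otimes> inv (inv h))"
        using conj_mult[of "inv h"] h(1) xy by (metis inv_closed)
      moreover have "inv h \<otimes> y' \<otimes> inv (inv h) = y" using conj_back h y by simp
      moreover have "inv h \<otimes> x' \<otimes> inv (inv h) = (inv h \<otimes> g) \<otimes> x \<otimes> inv (inv h \<otimes> g)"
        using g h(1) x by (simp add: inv_mult_group m_assoc)
      ultimately show ?thesis using g h(1) by (intro bexI[of _ "inv h \<otimes> g"]) simp_all
    qed
  qed
  then have X: "X = {x}" and xc: "x \<in> group_center G" using auto_orbit_central[OF A] x by auto
  have common: "\<exists>c\<in>carrier G. x \<in> generate G {c} \<and> y \<in> generate G {c}" if y: "y \<in> carrier G" for y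
  proof -
    consider "y = \<one>" | "auto_orbit A y = X" | y' where "y' \<in> auto_orbit A y"
      "cyclic_group (subgroup_generated G {x, y'})"
      using near y X by blast
    then show ?thesis
    proof cases
      case 1
      then show ?thesis using x by (intro bexI[of _ x]) (auto intro: generate.intros)
    next
      case 2
      then have "y = x" using auto_orbit_refl[OF A y] X by blast
      then show ?thesis using x by (intro bexI[of _ x]) (auto intro: generate.intros)
    next
      case 3
      obtain h where h: "h \<in> carrier G" "y' = h \<otimes> y \<otimes> inv h"
        using 3 auto_orbit_mem[OF A y] by blast
      obtain c where c: "c \<in> carrier G" "x \<in> generate G {c}" "y' \<in> generate G {c}"
        using cyclic_pair_generator[of x y'] 3 h x y by auto
      \<comment> \<open>Conjugating the common generator by h^-1 fixes the central x and takes y'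
        back to y.\<close>
      define d where "d = inv h \<otimes> c \<otimes> inv (inv h)"
      have d: "d \<in> carrier G" using h c by (simp add: d_def)
      have "inv h \<otimes> u \<otimes> inv (inv h) \<in> generate G {d}" if u: "u \<in> generate G {c}" for u
      proof -
        obtain k :: nat where "u = c [^] k" using in_generate_singleton_iff[OF fin c(1)] u by blast
        then have "inv h \<otimes> u \<otimes> inv (inv h) = d [^] k"
          using conj_nat_pow[of "inv h" c k] h c by (simp add: d_def)
        then show ?thesis using in_generate_singleton_iff[OF fin d] by blast
      qed
      from this[OF c(2)] this[OF c(3)] have "x \<in> generate G {d}" "y \<in> generate G {d}"
        using central_conj[OF xc inv_closed[OF h(1)]] conj_back[OF h(1) y] h(2) by (simp_all del: inv_inv)
      then show ?thesis using d by blast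
    qed
  qed
  have "ord x \<noteq> 1" using ord_eq_1 x by blast
  \<comment> \<open>Any prime divisor of ord x serves, with z = x^(ord x / p): each y shares a
    cyclic group with x and hence with z.\<close>
  then obtain p where p: "prime p" "p dvd ord x" using prime_factor_nat by blast
  then obtain k where k: "ord x = k * p" by (metis dvd_def mult.commute)
  then have "k \<noteq> 0" using ord_ge_1[OF fin x(1)] by auto
  define z where "z = x [^] k"
  have z: "z \<in> carrier G" "ord z = p"
    using x k \<open>k \<noteq> 0\<close> by (simp_all add: z_def ord_pow)
  have zx: "z \<in> generate G {x}" using in_generate_singleton_iff[OF fin x(1)] z_def by blast
  have "z \<in> group_center G"
    using generate_subgroup_incl[OF _ subgroup_group_center, of "{x}"] xc zx by blast
  moreover have "y \<in> generate G {z}" if y: "y \<in> carrier G" "y [^] p = \<one>" for y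
  proof -
    obtain c where c: "c \<in> carrier G" "x \<in> generate G {c}" "y \<in> generate G {c}"
      using common y by blast
    then have "z \<in> generate G {c}" using zx generate_singleton_subset by blast
    then show ?thesis using generate_prime_ord_eq[OF fin c(1) p(1)] z c y by blast
  qed
  ultimately have "central_unique_prime p z" using p z by (simp add: central_unique_prime_def)
  then show ?thesis by blast
qed

end

theorem theorem4:
  fixes G :: "('a, 'b) monoid_scheme" and A :: "('a \<Rightarrow> 'a) set"
  assumes "group G" and "finite (carrier G)" and "subgroup A (InnGroup G)"
  shows "(\<exists>X. universal_vertex (with_proj (automorphic_cyclic_graph G A)) X) \<longleftrightarrow>
    (\<exists>p. prime p \<and> p dvd card (group_center G) \<and>
      (\<exists>P. sylow_subgroup p P G \<and>
        (cyclic_group (G\<lparr>carrier := P\<rparr>) \<or> generalized_quaternion_group (G\<lparr>carrier := P\<rparr>))))"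
proof -
  interpret group G by fact
  show ?thesis
    using central_unique_prime_if_universal[OF assms(2,3)] universal_if_central_unique_prime[OF assms(2,3)]
      sylow_if_central_unique_prime[OF assms(2)] central_unique_prime_if_sylow[OF assms(2)]
    by metis
qed

end
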